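(* Let $M$ be a bipath module (a persistence module over the bipath poset $B$), let $\mathcal{B}(M) = (S,\mu)$ be its arc code, and let $\mathcal{B}(R(M)) = (S',\mu')$ be the barcode of the zigzag module $R(M) = M\circ\zeta$. Then the barcode $\mathcal{B}(R(M))$ is a complete invariant of $M$ up to isomorphism; that is, two bipath modules $M_1, M_2$ over $B$ are isomorphic if and only if $\mathcal{B}(R(M_1)) = \mathcal{B}(R(M_2))$. Moreover, there is a bijection $\phi\colon S \to S'/\mathbb{Z}$ such that $\mu'(\phi(I)) = \mu(I)$ for each $I\in S$, where $S'/\mathbb{Z}$ denotes the orbit space of $S'$ under the $\mathbb{Z}$-action $\uparrow$, and $\mu'$ of an orbit denotes the common value of $\mu'$ on the elements of that orbit.
   Context: Fix a field $\Bbbk$. A persistence module over a poset $P$ is a functor from $P$ (viewed as a category) to the category $\mathrm{Vec}$ of finite-dimensional $\Bbbk$-vector spaces; $\mathrm{Vec}^P$ is the category of these, with natural transformations as morphisms. An interval $I$ of $P$ is a non-empty, connected, convex subposet (convex: $p\le z\le q$ and $p,q\in I$ imply $z\in I$). The interval module $\Bbbk I$ has $(\Bbbk I)_p=\Bbbk$ for $p\in I$ and $0$ otherwise, with internal map $p\to q$ equal to the identity if $p,q\in I$ and $0$ otherwise. A multiset is a pair $(S,\mu)$ with $S$ a set and $\mu$ a function giving the multiplicity of each $s \in S$; in arc codes and barcodes below, $S$ is the set of intervals that occur, i.e. those with positive multiplicity. Bipath poset: fix integers $n,m>1$ and let $B=\{0,1,\dots,n+m-1\}$ with the partial order given by the two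 maximal chains $0<1<\cdots<n-1<n$ and $0<n+m-1<n+m-2<\cdots<n+1<n$. Set $N = n+m-1$. Every persistence module $M$ over $B$ is isomorphic to a direct sum of interval modules $\bigoplus_{I\in\mathcal{B}(M)}\Bbbk I$ for a unique multiset $\mathcal{B}(M)$ of intervals of $B$, called the arc code of $M$. Zigzag poset: $\mathbb{ZZ}=\{(a,b)\in\mathbb{Z}^{\mathrm{op}}\times\mathbb{Z} : a=b\text{ or }a=b+1\}$, a subposet of $\mathbb{Z}^{\mathrm{op}}\times\mathbb{Z}$. A zigzag module is a persistence module over $\mathbb{ZZ}$; every zigzag module $Z$ is isomorphic to $\bigoplus_{I\in\mathcal{B}(Z)}\Bbbk I$ for a unique multiset $\mathcal{B}(Z)$ of intervals of $\mathbb{ZZ}$, called its barcode. Covering map: the poset map $\zeta\colon\mathbb{ZZ}\to B$ given, for every $k\in\mathbb{Z}$, by $\zeta(kN+1,kN)=0$; $\zeta(kN+i,kN+i)=\zeta(kN+i+1,kN+i)=i$ for $i\in\{1,\dots,n-1\}$; $\zeta(kN+n,kN+n)=n$; $\zeta(kN-i+1,kN-i)=\zeta(kN-i+1,kN-i+1)=n+m-i$ for $i\in\{1,\dots,m-1\}$. The restriction functor $R\colon\mathrm{Vec}^B\to\mathrm{Vec}^{\mathbb{ZZ}}$ is $M\mapsto M\circ\zeta$. Action: $z\in\mathbb{Z}$ acts on an interval $J$ of $\mathbb{ZZ}$ by adding $zN$ to each endpoint, i.e. $z\uparrow J=\{(a+zN,b+zN) : (a,b)\in J\}$. For a bipath module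 $M$ this gives a multiplicity-preserving action of $\mathbb{Z}$ on $\mathcal{B}(R(M))=(S',\mu')$, i.e. $z\uparrow J\in S'$ and $\mu'(z\uparrow J)=\mu'(J)$ for $J\in S'$. *)

theory Defs
  imports Complex_Main "HOL-Library.Function_Algebras"
begin

text \<open>
  A poset is given by a carrier \<open>P\<close> and a relation \<open>le\<close>, of which only the restriction to \<open>P\<close>
  matters.  The spaces of a module are subspaces of one common vector space: the type \<open>'v\<close> with
  scalar multiplication \<open>pm_scale\<close>, of arbitrary dimension.  This is no restriction up to
  isomorphism, as a family of vector spaces embeds in its direct sum.  The map \<open>pm_map M p q\<close>
  is relevant only for \<open>le p q\<close>, and only on \<open>pm_space M p\<close>.
\<close>

record ('p, 'k, 'v) pmod =
  pm_scale :: "'k \<Rightarrow> 'v \<Rightarrow> 'v"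
  pm_space :: "'p \<Rightarrow> 'v set"
  pm_map :: "'p \<Rightarrow> 'p \<Rightarrow> 'v \<Rightarrow> 'v"

definition linear_between ::
  "('k \<Rightarrow> 'v \<Rightarrow> 'v) \<Rightarrow> 'v set \<Rightarrow> ('k \<Rightarrow> 'w \<Rightarrow> 'w) \<Rightarrow> 'w set
    \<Rightarrow> ('v::ab_group_add \<Rightarrow> 'w::ab_group_add) \<Rightarrow> bool" where
  "linear_between s V t W f \<longleftrightarrow>
     (\<forall>x\<in>V. f x \<in> W) \<and>
     (\<forall>x\<in>V. \<forall>y\<in>V. f (x + y) = f x + f y) \<and>
     (\<forall>c. \<forall>x\<in>V. f (s c x) = t c (f x))"

definition persistence_module ::
  "'p set \<Rightarrow> ('p \<Rightarrow> 'p \<Rightarrow> bool) \<Rightarrow> ('p, 'k::field, 'v::ab_group_add) pmod \<Rightarrow> bool" where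
  "persistence_module P le M \<longleftrightarrow>
     vector_space (pm_scale M) \<and>
     (\<forall>p\<in>P. \<exists>A. finite A \<and> pm_space M p = module.span (pm_scale M) A) \<and>
     (\<forall>p\<in>P. \<forall>q\<in>P. le p q \<longrightarrow>
        linear_between (pm_scale M) (pm_space M p) (pm_scale M) (pm_space M q) (pm_map M p q)) \<and>
     (\<forall>p\<in>P. \<forall>x\<in>pm_space M p. pm_map M p p x = x) \<and>
     (\<forall>p\<in>P. \<forall>q\<in>P. \<forall>r\<in>P. le p q \<longrightarrow> le q r \<longrightarrow>
        (\<forall>x\<in>pm_space M p. pm_map M q r (pm_map M p q x) = pm_map M p r x))"

definition pm_hom ::
  "'p set \<Rightarrow> ('p \<Rightarrow> 'p \<Rightarrow> bool) \<Rightarrow> ('p, 'k::field, 'v::ab_group_add) pmod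
    \<Rightarrow> ('p, 'k, 'w::ab_group_add) pmod \<Rightarrow> ('p \<Rightarrow> 'v \<Rightarrow> 'w) \<Rightarrow> bool" where
  "pm_hom P le M N h \<longleftrightarrow>
     (\<forall>p\<in>P. linear_between (pm_scale M) (pm_space M p) (pm_scale N) (pm_space N p) (h p)) \<and>
     (\<forall>p\<in>P. \<forall>q\<in>P. le p q \<longrightarrow>
        (\<forall>x\<in>pm_space M p. h q (pm_map M p q x) = pm_map N p q (h p x)))"

definition pm_iso ::
  "'p set \<Rightarrow> ('p \<Rightarrow> 'p \<Rightarrow> bool) \<Rightarrow> ('p, 'k::field, 'v::ab_group_add) pmod
    \<Rightarrow> ('p, 'k, 'w::ab_group_add) pmod \<Rightarrow> bool" where
  "pm_iso P le M N \<longleftrightarrow>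
     (\<exists>h g. pm_hom P le M N h \<and> pm_hom P le N M g \<and>
        (\<forall>p\<in>P. (\<forall>x\<in>pm_space M p. g p (h p x) = x) \<and> (\<forall>y\<in>pm_space N p. h p (g p y) = y)))"

definition is_interval_of :: "'p set \<Rightarrow> ('p \<Rightarrow> 'p \<Rightarrow> bool) \<Rightarrow> 'p set \<Rightarrow> bool" where
  "is_interval_of P le I \<longleftrightarrow>
     I \<subseteq> P \<and> I \<noteq> {} \<and>
     (\<forall>p\<in>I. \<forall>q\<in>I. \<forall>z\<in>P. le p z \<longrightarrow> le z q \<longrightarrow> z \<in> I) \<and>
     (\<forall>p\<in>I. \<forall>q\<in>I. (p, q) \<in> {(x, y). x \<in> I \<and> y \<in> I \<and> (le x y \<or> le y x)}\<^sup>*)"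

definition interval_module :: "'p set \<Rightarrow> ('p, 'k::field, 'k) pmod" where
  "interval_module I =
     \<lparr> pm_scale = (*),
       pm_space = (\<lambda>p. if p \<in> I then UNIV else {0}),
       pm_map = (\<lambda>p q x. if p \<in> I \<and> q \<in> I then x else 0) \<rparr>"

definition direct_sum_pm ::
  "'i set \<Rightarrow> ('i \<Rightarrow> ('p, 'k::field, 'v::ab_group_add) pmod) \<Rightarrow> ('p, 'k, 'i \<Rightarrow> 'v) pmod" where
  "direct_sum_pm A N =
     \<lparr> pm_scale = (\<lambda>c x i. pm_scale (N i) c (x i)),
       pm_space = (\<lambda>p. {x. finite {i. x i \<noteq> 0} \<and> (\<forall>i\<in>A. x i \<in> pm_space (N i) p) \<and>
                            (\<forall>i. i \<notin> A \<longrightarrow> x i = 0)}),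
       pm_map = (\<lambda>p q x i. if i \<in> A then pm_map (N i) p q (x i) else 0) \<rparr>"

text \<open>
  A multiset of intervals \<open>(S, \<mu>)\<close> is encoded by its multiplicity function, extended by \<open>0\<close>
  outside \<open>S\<close>; so \<open>S\<close> is \<open>occurring \<mu>\<close>, and equality of functions is equality of multisets.  The
  support may be infinite, as for the barcode of a zigzag module.
  Multiplicities in an interval decomposition are finite because the spaces are
  finite-dimensional.  The direct sum ranges over the copies \<open>(I, j)\<close> of \<open>I\<close> with \<open>j < \<mu> I\<close>.
\<close>

definition occurring :: "('p set \<Rightarrow> nat) \<Rightarrow> 'p set set" where
  "occurring \<mu> = {I. 0 < \<mu> I}"

definition is_interval_decomposition ::
  "'p set \<Rightarrow> ('p \<Rightarrow> 'p \<Rightarrow> bool) \<Rightarrow> ('p, 'k::field, 'v::ab_group_add) pmod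
    \<Rightarrow> ('p set \<Rightarrow> nat) \<Rightarrow> bool" where
  "is_interval_decomposition P le M \<mu> \<longleftrightarrow>
     (\<forall>I\<in>occurring \<mu>. is_interval_of P le I) \<and>
     pm_iso P le M (direct_sum_pm {(I, j). j < \<mu> I} (\<lambda>(I, j). interval_module I))"

definition interval_multiset ::
  "'p set \<Rightarrow> ('p \<Rightarrow> 'p \<Rightarrow> bool) \<Rightarrow> ('p, 'k::field, 'v::ab_group_add) pmod
    \<Rightarrow> ('p set \<Rightarrow> nat)" where
  "interval_multiset P le M = (THE \<mu>. is_interval_decomposition P le M \<mu>)"

definition bipath_carrier :: "nat \<Rightarrow> nat \<Rightarrow> nat set" where
  "bipath_carrier n m = {..<n + m}"

text \<open>
  The three clauses are the chain \<open>0 < 1 < \<dots> < n\<close>, the part \<open>n + m - 1 < \<dots> < n + 1 < n\<close> of the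
  second chain, and the minimality of \<open>0\<close>.
\<close>

definition bipath_le :: "nat \<Rightarrow> nat \<Rightarrow> nat \<Rightarrow> nat \<Rightarrow> bool" where
  "bipath_le n m i j \<longleftrightarrow>
     (i \<le> j \<and> j \<le> n) \<or> (n \<le> j \<and> j \<le> i \<and> i < n + m) \<or> (i = 0 \<and> j < n + m)"

definition bipath_module :: "nat \<Rightarrow> nat \<Rightarrow> (nat, 'k::field, 'v::ab_group_add) pmod \<Rightarrow> bool" where
  "bipath_module n m M \<longleftrightarrow> persistence_module (bipath_carrier n m) (bipath_le n m) M"

definition bipath_iso ::
  "nat \<Rightarrow> nat \<Rightarrow> (nat, 'k::field, 'v::ab_group_add) pmod
    \<Rightarrow> (nat, 'k, 'w::ab_group_add) pmod \<Rightarrow> bool" where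
  "bipath_iso n m M N \<longleftrightarrow> pm_iso (bipath_carrier n m) (bipath_le n m) M N"

definition arc_code ::
  "nat \<Rightarrow> nat \<Rightarrow> (nat, 'k::field, 'v::ab_group_add) pmod \<Rightarrow> (nat set \<Rightarrow> nat)" where
  "arc_code n m M = interval_multiset (bipath_carrier n m) (bipath_le n m) M"

definition zz_carrier :: "(int \<times> int) set" where
  "zz_carrier = {(a, b). a = b \<or> a = b + 1}"

text \<open>The order of \<open>\<int>\<^sup>o\<^sup>p \<times> \<int>\<close>.\<close>

definition zz_le :: "int \<times> int \<Rightarrow> int \<times> int \<Rightarrow> bool" where
  "zz_le x y \<longleftrightarrow> fst y \<le> fst x \<and> snd x \<le> snd y"

definition barcode :: "(int \<times> int, 'k::field, 'v::ab_group_add) pmod \<Rightarrow> ((int \<times> int) set \<Rightarrow> nat)"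
  where "barcode Z = interval_multiset zz_carrier zz_le Z"

text \<open>
  Closed form of the covering map in terms of \<open>r = b mod N\<close>, where \<open>N = n + m - 1\<close>.  That it takes
  the prescribed values is lemma \<open>covering_values\<close>.
\<close>

definition covering :: "nat \<Rightarrow> nat \<Rightarrow> int \<times> int \<Rightarrow> nat" where
  "covering n m = (\<lambda>(a, b).
     let N = n + m - 1; r = nat (b mod int N) in
       if a = b then (if r = 0 then N else r)
       else (if r < n then r else r + 1))"

lemma covering_values:
  fixes n m :: nat and k i :: int
  assumes "n > 1" and "m > 1"
  defines "N \<equiv> int (n + m - 1)"
  shows "covering n m (k * N + 1, k * N) = 0"
    and "1 \<le> i \<Longrightarrow> i \<le> int n - 1 \<Longrightarrow> covering n m (k * N + i, k * N + i) = nat i"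
    and "1 \<le> i \<Longrightarrow> i \<le> int n - 1 \<Longrightarrow> covering n m (k * N + i + 1, k * N + i) = nat i"
    and "covering n m (k * N + int n, k * N + int n) = n"
    and "1 \<le> i \<Longrightarrow> i \<le> int m - 1 \<Longrightarrow>
           covering n m (k * N - i + 1, k * N - i) = nat (int n + int m - i)"
    and "1 \<le> i \<Longrightarrow> i \<le> int m - 1 \<Longrightarrow>
           covering n m (k * N - i + 1, k * N - i + 1) = nat (int n + int m - i)"
proof -
  have N: "N = int n + int m - 1" "N > 0" and NN: "int (n + m - 1) = N"
    using assms by (auto simp: N_def)
  have md: "(k * N + r) mod N = r" if "0 \<le> r" "r < N" for k r :: int
    using that by simp
  show "covering n m (k * N + 1, k * N) = 0"
    using assms(1) unfolding covering_def Let_def NN by auto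
  show "covering n m (k * N + i, k * N + i) = nat i" if "1 \<le> i" "i \<le> int n - 1"
    using that N md[of i k] assms(2) unfolding covering_def Let_def NN by auto
  show "covering n m (k * N + i + 1, k * N + i) = nat i" if "1 \<le> i" "i \<le> int n - 1"
    using that N md[of i k] assms(2) unfolding covering_def Let_def NN by auto
  show "covering n m (k * N + int n, k * N + int n) = n"
    using N md[of "int n" k] assms(1,2) unfolding covering_def Let_def NN by auto
  have e: "k * N - j = (k - 1) * N + (N - j)" for j
    by (simp add: algebra_simps)
  have md': "(k * N - j) mod N = N - j" if "1 \<le> j" "j \<le> N" for j
    using md[of "N - j" "k - 1"] that unfolding e by simp
  show "covering n m (k * N - i + 1, k * N - i) = nat (int n + int m - i)"
    if "1 \<le> i" "i \<le> int m - 1"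
    using that N md'[of i] assms(1,2) unfolding covering_def Let_def NN by auto
  show "covering n m (k * N - i + 1, k * N - i + 1) = nat (int n + int m - i)"
    if "1 \<le> i" "i \<le> int m - 1"
  proof (cases "i = 1")
    case True
    then show ?thesis
      using N assms(1,2) unfolding covering_def Let_def NN by (auto simp: N_def)
  next
    case False
    have "(k * N - (i - 1)) mod N = N - (i - 1)"
      by (rule md') (use that N(1) False assms(1) in auto)
    then have "(k * N - i + 1) mod N = N - i + 1"
      by (simp only: diff_diff_eq2 diff_add_eq)
    then show ?thesis
      using that N False assms(1,2) unfolding covering_def Let_def NN by auto
  qed
qed

definition restriction ::
  "nat \<Rightarrow> nat \<Rightarrow> (nat, 'k, 'v) pmod \<Rightarrow> (int \<times> int, 'k, 'v) pmod" where
  "restriction n m M =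
     \<lparr> pm_scale = pm_scale M,
       pm_space = (\<lambda>x. pm_space M (covering n m x)),
       pm_map = (\<lambda>x y. pm_map M (covering n m x) (covering n m y)) \<rparr>"

definition shift :: "nat \<Rightarrow> nat \<Rightarrow> int \<Rightarrow> (int \<times> int) set \<Rightarrow> (int \<times> int) set" where
  "shift n m z J = (\<lambda>(a, b). (a + z * int (n + m - 1), b + z * int (n + m - 1))) ` J"

definition orbit_space :: "nat \<Rightarrow> nat \<Rightarrow> (int \<times> int) set set \<Rightarrow> (int \<times> int) set set set" where
  "orbit_space n m S' = (\<lambda>J. {shift n m z J |z. True}) ` S'"

end

theory Submission
  imports Defs
begin

text \<open>
  A morphism from the interval module of \<open>I\<close> to \<open>M\<close> is a compatible family of vectors over \<open>I\<close> (a
  section), a morphism the other way is a compatible family of functionals (a cosection).  An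
  interval decomposition of \<open>M\<close> is therefore the same as an indexed family of sections that restrict
  to a basis of every space of \<open>M\<close>; the functionals of the dual bases are then cosections.  The
  whole argument is carried out with such interval bases.

  Uniqueness holds over every poset.  If both composites of the interval modules of \<open>I\<close> and \<open>J\<close>
  through \<open>M\<close> are non-zero at one point, connectedness forces \<open>I = J\<close> (lemma
  \<open>interval_eq_of_pairing\<close>).  So, when two interval bases are compared, the vectors of one belonging
  to \<open>I\<close> see only those of the other belonging to \<open>I\<close>, and there cannot be more of them
  (\<open>card_copies_le\<close>).

  Existence for bipath modules is an induction on the total dimension: it is enough that a non-zero
  module has one section and one cosection on a common interval which pair to \<open>1\<close>, because the
  kernel of the cosection is a complement (\<open>interval_basis_insert\<close>).  If the map from the minimum
  to the maximum is non-zero, it gives a summand on the full poset.  Otherwise the kernels in the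
  space at the minimum of the maps along the two chains form two exhausting flags, and a vector that
  is extremal for both generates a summand; the images in the space at the maximum are treated
  dually.  If both these spaces vanish, the module is a sum of two modules over linear orders
  (\<open>bipath_summand\<close>).

  An interval basis pulls back along any order-preserving map: each section is cut up along the
  connected components of the preimage of its interval (\<open>interval_basis_pullback\<close>).  For the covering
  map, every component of the preimage of an interval \<open>I\<close> is mapped onto \<open>I\<close>, by lifting paths, and
  the components form a single orbit of the action, since each fibre does up to a path inside it
  (\<open>covering_image_lift\<close>, \<open>lifts_eq_orbit\<close>).  Hence the multiplicity of a component of the preimage of
  \<open>I\<close> in the barcode is that of \<open>I\<close> in the arc code.  The bijection sends \<open>I\<close> to the set of these
  components, and the barcode determines the arc code and thereby the module.
\<close>

section \<open>Linear algebra on subspaces\<close>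

lemma vector_space_field: "vector_space ((*) :: 'k::field \<Rightarrow> 'k \<Rightarrow> 'k)"
  by unfold_locales (auto simp: algebra_simps)

lemma linear_betweenD:
  assumes "linear_between s V t W f"
  shows "x \<in> V \<Longrightarrow> f x \<in> W"
    and "x \<in> V \<Longrightarrow> y \<in> V \<Longrightarrow> f (x + y) = f x + f y"
    and "x \<in> V \<Longrightarrow> f (s c x) = t c (f x)"
  using assms unfolding linear_between_def by blast+

lemma linear_between_comp:
  assumes "linear_between s V t W f" "linear_between t W r Z g"
  shows "linear_between s V r Z (\<lambda>x. g (f x))"
  using assms unfolding linear_between_def by simp

lemma linear_between_mono:
  "linear_between s V t W f \<Longrightarrow> V' \<subseteq> V \<Longrightarrow> W \<subseteq> W' \<Longrightarrow> linear_between s V' t W' f"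
  unfolding linear_between_def by blast

lemma linear_between_global:
  "Vector_Spaces.linear s t f \<Longrightarrow> linear_between s V t UNIV f"
  unfolding linear_between_def by (simp add: Vector_Spaces.linear_iff)

context vector_space
begin

lemma linear_between_zero:
  assumes "linear_between scale V t W f" "subspace V"
  shows "f 0 = 0"
  using linear_betweenD(2)[OF assms(1), of 0 0] subspace_0[OF assms(2)] by simp

lemma linear_between_diff:
  assumes "linear_between scale V t W f" "subspace V" "x \<in> V" "y \<in> V"
  shows "f (x - y) = f x - f y"
  using linear_betweenD(2)[OF assms(1), of "x - y" y] assms(2-4) by (simp add: subspace_diff)

lemma linear_between_sum:
  assumes f: "linear_between scale V t W f" and V: "subspace V" and u: "\<And>a. a \<in> A \<Longrightarrow> u a \<in> V"
  shows "f (\<Sum>a\<in>A. u a) = (\<Sum>a\<in>A. f (u a))"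
proof (cases "finite A")
  case True
  then show ?thesis
    using u
  proof (induction A)
    case empty
    show ?case
      using linear_between_zero[OF f V] by simp
  next
    case (insert a A)
    have "(\<Sum>a\<in>A. u a) \<in> V"
      by (rule subspace_sum[OF V]) (use insert in auto)
    then show ?case
      using insert linear_betweenD(2)[OF f] by simp
  qed
qed (use linear_between_zero[OF f V] in simp)

lemma subspace_linear_between_kernel:
  assumes f: "linear_between scale V t W f" and V: "subspace V" and "vector_space t"
  shows "subspace {v \<in> V. f v = 0}"
proof -
  interpret T: vector_space t by fact
  show ?thesis
    using linear_betweenD[OF f] linear_between_zero[OF f V] V
    by (auto simp: subspace_def)
qed

lemma subspace_linear_between_image:
  assumes f: "linear_between t V scale W f" and "vector_space t" and V: "module.subspace t V"
  shows "subspace (f ` V)"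
proof -
  interpret T: vector_space t by fact
  show ?thesis
  proof (rule subspaceI)
    show "0 \<in> f ` V"
      using T.linear_between_zero[OF f V] T.subspace_0[OF V] by force
    show "x + y \<in> f ` V" if "x \<in> f ` V" "y \<in> f ` V" for x y
      using that linear_betweenD(2)[OF f] T.subspace_add[OF V] by (auto simp: image_iff) metis
    show "scale c x \<in> f ` V" if "x \<in> f ` V" for c x
      using that linear_betweenD(3)[OF f] T.subspace_scale[OF V] by (auto simp: image_iff) metis
  qed
qed

lemma functional_separating:
  assumes U: "subspace U" and x: "x \<notin> U"
  shows "\<exists>\<phi>. linear_between scale UNIV (*) UNIV \<phi> \<and> (\<forall>u\<in>U. \<phi> u = 0) \<and> \<phi> x = 1"
proof -
  interpret F: vector_space "(*) :: 'a \<Rightarrow> 'a \<Rightarrow> 'a" by (rule vector_space_field)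
  interpret vector_space_pair scale "(*) :: 'a \<Rightarrow> 'a \<Rightarrow> 'a" ..
  obtain B where B: "B \<subseteq> U" "independent B" "U \<subseteq> span B"
    using maximal_independent_subset[of U] by blast
  have UB: "span B = U"
    using B U by (metis span_minimal subset_antisym)
  have "independent (insert x B)"
    using B x UB by (simp add: independent_insertI)
  then obtain g where g: "Vector_Spaces.linear scale (*) g"
    "\<forall>y\<in>insert x B. g y = (if y = x then 1 else 0)"
    using linear_independent_extend[of "insert x B" "\<lambda>y. if y = x then 1 else 0"] by blast
  have "g u = 0" if "u \<in> U" for u
  proof (rule linear_eq_0_on_span[OF g(1), of B])
    show "u \<in> span B"
      using that UB by simp
    show "g b = 0" if "b \<in> B" for b
      using that g(2) x B(1) by auto
  qed
  then show ?thesis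
    using g linear_between_global[OF g(1)] by auto
qed

text \<open>
  The dual of an injection is surjective: extend \<open>f\<close> to the whole space, invert it on the left
  with values in \<open>V\<close>, and follow by \<open>\<phi>\<close>.
\<close>

lemma functional_extension:
  assumes V: "subspace V" and f: "linear_between scale V scale W f" and inj: "inj_on f V"
    and \<phi>: "linear_between scale V (*) UNIV \<phi>"
  shows "\<exists>\<psi>. linear_between scale UNIV (*) UNIV \<psi> \<and> (\<forall>v\<in>V. \<psi> (f v) = \<phi> v)"
proof -
  interpret vector_space_pair scale scale ..
  obtain B where B: "B \<subseteq> V" "independent B" "V \<subseteq> span B"
    using maximal_independent_subset[of V] by blast
  obtain g where g: "Vector_Spaces.linear scale scale g" "\<forall>x\<in>B. g x = f x"
    using linear_independent_extend[OF B(2)] by blast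
  note g' = linear_between_global[OF g(1), of V]
  have gf: "g v = f v" if "v \<in> V" for v
  proof -
    have "subspace {v \<in> V. g v = f v}"
      using linear_betweenD(2,3)[OF f] linear_betweenD(2,3)[OF g'] V
        linear_between_zero[OF f V] linear_between_zero[OF g' V]
      by (auto simp: subspace_def)
    then have "span B \<subseteq> {v \<in> V. g v = f v}"
      by (rule span_minimal[rotated]) (use B g in auto)
    then show ?thesis
      using B(3) that by blast
  qed
  have "inj_on g V"
    using inj gf by (auto simp: inj_on_def)
  from linear_exists_left_inverse_on[OF g(1) V this]
  obtain h where h: "h ` UNIV \<subseteq> V" "Vector_Spaces.linear scale scale h" "\<forall>v\<in>V. h (g v) = v"
    by blast
  have "linear_between scale UNIV scale V h"
    using h(1) linear_between_global[OF h(2), of UNIV] by (auto simp: linear_between_def)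
  from linear_between_comp[OF this \<phi>] show ?thesis
    using h(3) gf by (intro exI[of _ "\<lambda>x. \<phi> (h x)"]) auto
qed

lemma dim_less_finite:
  assumes K: "subspace K" "K \<subseteq> V" and V: "V \<subseteq> span T" "finite T" and x: "x \<in> V" "x \<notin> K"
  shows "dim K < dim V"
proof -
  obtain B where B: "B \<subseteq> K" "independent B" "K \<subseteq> span B" "card B = dim K"
    using basis_exists by blast
  obtain C where C: "C \<subseteq> V" "independent C" "V \<subseteq> span C" "card C = dim V"
    using basis_exists by blast
  have fC: "finite C"
    using independent_span_bound[OF V(2) C(2)] C(1) V(1) by blast
  have xB: "x \<notin> span B"
    using B K x by (metis span_minimal subsetD)
  then have "independent (insert x B)"
    using B(2) by (simp add: independent_insertI)
  from independent_span_bound[OF fC this] B(1) K(2) C(3) x(1)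
  have "finite (insert x B)" "card (insert x B) \<le> card C"
    by auto
  moreover have "x \<notin> B"
    using xB span_base by blast
  ultimately show ?thesis
    using B(4) C(4) by simp
qed

text \<open>A family with dual functionals is linearly independent.\<close>

lemma dual_family_card:
  assumes V: "subspace V" and u: "\<And>a. a \<in> A \<Longrightarrow> u a \<in> V"
    and \<phi>: "\<And>a. a \<in> A \<Longrightarrow> linear_between scale V (*) UNIV (\<phi> a)"
    and dual: "\<And>a b. a \<in> A \<Longrightarrow> b \<in> A \<Longrightarrow> \<phi> a (u b) = (if a = b then 1 else 0)"
    and T: "finite T" "\<And>a. a \<in> A \<Longrightarrow> u a \<in> span T"
  shows "finite A \<and> card A \<le> card T"
proof -
  have inj: "inj_on u A"
  proof (rule inj_onI)
    fix a b assume ab: "a \<in> A" "b \<in> A" "u a = u b"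
    have "\<phi> a (u a) = 1" "\<phi> a (u b) = (if a = b then 1 else 0)"
      using dual[OF ab(1,1)] dual[OF ab(1,2)] by simp_all
    then show "a = b"
      using ab(3) by (auto split: if_splits)
  qed
  have "independent (u ` A)"
    unfolding independent_explicit_finite_subsets
  proof (intro allI impI ballI)
    fix S c v assume S: "S \<subseteq> u ` A" "finite S" "(\<Sum>v\<in>S. scale (c v) v) = 0" "v \<in> S"
    then obtain a where a: "a \<in> A" "v = u a"
      by blast
    have "0 = \<phi> a (\<Sum>v\<in>S. scale (c v) v)"
      using S(3) linear_between_zero[OF \<phi>[OF a(1)] V] by simp
    also have "\<dots> = (\<Sum>w\<in>S. \<phi> a (scale (c w) w))"
      by (rule linear_between_sum[OF \<phi>[OF a(1)] V])
        (use S(1) u subspace_scale[OF V] in blast)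
    also have "\<dots> = (\<Sum>w\<in>S. if w = v then c w else 0)"
    proof (rule sum.cong[OF refl])
      fix w assume "w \<in> S"
      then obtain b where b: "b \<in> A" "w = u b"
        using S(1) by blast
      have "a = b \<longleftrightarrow> w = v"
        using a b inj by (auto simp: inj_on_def)
      then show "\<phi> a (scale (c w) w) = (if w = v then c w else 0)"
        using linear_betweenD(3)[OF \<phi>[OF a(1)] u[OF b(1)]] dual[OF a(1) b(1)] b(2) by auto
    qed
    also have "\<dots> = c v"
      using S by simp
    finally show "c v = 0" ..
  qed
  from independent_span_bound[OF T(1) this] T(2)
  have "finite (u ` A) \<and> card (u ` A) \<le> card T"
    by blast
  then show ?thesis
    using inj card_image finite_image_iff by metis
qed

end

section \<open>Interval bases\<close>

text \<open>
  A section of \<open>M\<close> on \<open>I\<close> is a morphism from the interval module of \<open>I\<close> to \<open>M\<close> (the images of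
  \<open>1\<close>), a cosection is one from \<open>M\<close> to the interval module.  Values outside \<open>I\<close> are arbitrary.
\<close>

definition interval_section ::
  "'p set \<Rightarrow> ('p \<Rightarrow> 'p \<Rightarrow> bool) \<Rightarrow> ('p, 'k::field, 'v::ab_group_add) pmod \<Rightarrow> 'p set
    \<Rightarrow> ('p \<Rightarrow> 'v) \<Rightarrow> bool" where
  "interval_section P le M I x \<longleftrightarrow>
     (\<forall>p\<in>I. x p \<in> pm_space M p) \<and>
     (\<forall>p\<in>I. \<forall>q\<in>P. le p q \<longrightarrow> pm_map M p q (x p) = (if q \<in> I then x q else 0))"

definition interval_cosection ::
  "'p set \<Rightarrow> ('p \<Rightarrow> 'p \<Rightarrow> bool) \<Rightarrow> ('p, 'k::field, 'v::ab_group_add) pmod \<Rightarrow> 'p set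
    \<Rightarrow> ('p \<Rightarrow> 'v \<Rightarrow> 'k) \<Rightarrow> bool" where
  "interval_cosection P le M I \<phi> \<longleftrightarrow>
     (\<forall>p\<in>I. linear_between (pm_scale M) (pm_space M p) (*) UNIV (\<phi> p)) \<and>
     (\<forall>p\<in>P. \<forall>q\<in>I. le p q \<longrightarrow>
        (\<forall>v\<in>pm_space M p. \<phi> q (pm_map M p q v) = (if p \<in> I then \<phi> p v else 0)))"

text \<open>
  The vectors \<open>x a p\<close> with \<open>p \<in> J a\<close> form a basis of the space at \<open>p\<close>, with coordinates \<open>\<phi> a p\<close>.
  Having the coordinates as part of the data makes both directions of the isomorphism with a direct
  sum explicit.
\<close>

definition interval_basis ::
  "'p set \<Rightarrow> ('p \<Rightarrow> 'p \<Rightarrow> bool) \<Rightarrow> ('p, 'k::field, 'v::ab_group_add) pmod \<Rightarrow> 'i set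
    \<Rightarrow> ('i \<Rightarrow> 'p set) \<Rightarrow> ('i \<Rightarrow> 'p \<Rightarrow> 'v) \<Rightarrow> ('i \<Rightarrow> 'p \<Rightarrow> 'v \<Rightarrow> 'k) \<Rightarrow> bool" where
  "interval_basis P le M A J x \<phi> \<longleftrightarrow>
     (\<forall>a\<in>A. is_interval_of P le (J a)) \<and>
     (\<forall>p\<in>P. finite {a \<in> A. p \<in> J a}) \<and>
     (\<forall>a\<in>A. interval_section P le M (J a) (x a)) \<and>
     (\<forall>a\<in>A. \<forall>p\<in>J a. linear_between (pm_scale M) (pm_space M p) (*) UNIV (\<phi> a p)) \<and>
     (\<forall>a\<in>A. \<forall>b\<in>A. \<forall>p. p \<in> J a \<longrightarrow> p \<in> J b \<longrightarrow> \<phi> a p (x b p) = (if a = b then 1 else 0)) \<and>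
     (\<forall>p\<in>P. \<forall>v\<in>pm_space M p. v = (\<Sum>a\<in>{a \<in> A. p \<in> J a}. pm_scale M (\<phi> a p v) (x a p)))"

lemma interval_sectionD:
  assumes "interval_section P le M I x"
  shows "p \<in> I \<Longrightarrow> x p \<in> pm_space M p"
    and "p \<in> I \<Longrightarrow> q \<in> P \<Longrightarrow> le p q \<Longrightarrow> pm_map M p q (x p) = (if q \<in> I then x q else 0)"
  using assms unfolding interval_section_def by blast+

lemma interval_cosectionD:
  assumes "interval_cosection P le M I \<phi>"
  shows "p \<in> I \<Longrightarrow> linear_between (pm_scale M) (pm_space M p) (*) UNIV (\<phi> p)"
    and "p \<in> P \<Longrightarrow> q \<in> I \<Longrightarrow> le p q \<Longrightarrow> v \<in> pm_space M p \<Longrightarrow>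
           \<phi> q (pm_map M p q v) = (if p \<in> I then \<phi> p v else 0)"
  using assms unfolding interval_cosection_def by blast+

lemma interval_basisD:
  assumes "interval_basis P le M A J x \<phi>"
  shows "a \<in> A \<Longrightarrow> is_interval_of P le (J a)"
    and "p \<in> P \<Longrightarrow> finite {a \<in> A. p \<in> J a}"
    and "a \<in> A \<Longrightarrow> interval_section P le M (J a) (x a)"
    and "a \<in> A \<Longrightarrow> p \<in> J a \<Longrightarrow> linear_between (pm_scale M) (pm_space M p) (*) UNIV (\<phi> a p)"
    and "a \<in> A \<Longrightarrow> b \<in> A \<Longrightarrow> p \<in> J a \<Longrightarrow> p \<in> J b \<Longrightarrow> \<phi> a p (x b p) = (if a = b then 1 else 0)"
    and "p \<in> P \<Longrightarrow> v \<in> pm_space M p \<Longrightarrow>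
           (\<Sum>a\<in>{a \<in> A. p \<in> J a}. pm_scale M (\<phi> a p v) (x a p)) = v"
  using assms unfolding interval_basis_def by simp_all

lemma is_interval_ofD:
  assumes "is_interval_of P le I"
  shows "I \<subseteq> P" "I \<noteq> {}"
    and "p \<in> I \<Longrightarrow> q \<in> I \<Longrightarrow> z \<in> P \<Longrightarrow> le p z \<Longrightarrow> le z q \<Longrightarrow> z \<in> I"
    and "p \<in> I \<Longrightarrow> q \<in> I \<Longrightarrow> (p, q) \<in> {(x, y). x \<in> I \<and> y \<in> I \<and> (le x y \<or> le y x)}\<^sup>*"
  using assms unfolding is_interval_of_def by blast+

lemma interval_connected_induct [consumes 3, case_names refl up down]:
  assumes "is_interval_of P le I" "p \<in> I" "q \<in> I" "Q p"
    and "\<And>y z. y \<in> I \<Longrightarrow> z \<in> I \<Longrightarrow> le y z \<Longrightarrow> Q y \<Longrightarrow> Q z"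
    and "\<And>y z. y \<in> I \<Longrightarrow> z \<in> I \<Longrightarrow> le z y \<Longrightarrow> Q y \<Longrightarrow> Q z"
  shows "Q q"
  using is_interval_ofD(4)[OF assms(1-3)]
proof (induction rule: rtrancl_induct)
  case (step y z)
  then show ?case
    using assms(5,6)[of y z] by auto
qed (fact assms(4))

locale pers_module =
  fixes P :: "'p set" and le :: "'p \<Rightarrow> 'p \<Rightarrow> bool" and M :: "('p, 'k::field, 'v::ab_group_add) pmod"
  assumes pm: "persistence_module P le M"

sublocale pers_module \<subseteq> vector_space "pm_scale M"
  using pm unfolding persistence_module_def by blast

context pers_module
begin

lemma finite_span: "p \<in> P \<Longrightarrow> \<exists>T. finite T \<and> pm_space M p = span T"
  using pm unfolding persistence_module_def by blast

lemma subspace_space: "p \<in> P \<Longrightarrow> subspace (pm_space M p)"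
  using finite_span by fastforce

lemma map_linear:
  "p \<in> P \<Longrightarrow> q \<in> P \<Longrightarrow> le p q \<Longrightarrow>
     linear_between (pm_scale M) (pm_space M p) (pm_scale M) (pm_space M q) (pm_map M p q)"
  using pm unfolding persistence_module_def by blast

lemma map_in: "p \<in> P \<Longrightarrow> q \<in> P \<Longrightarrow> le p q \<Longrightarrow> v \<in> pm_space M p \<Longrightarrow> pm_map M p q v \<in> pm_space M q"
  by (rule linear_betweenD(1)[OF map_linear])

lemma map_id: "p \<in> P \<Longrightarrow> v \<in> pm_space M p \<Longrightarrow> pm_map M p p v = v"
  using pm unfolding persistence_module_def by blast

lemma map_comp:
  "p \<in> P \<Longrightarrow> q \<in> P \<Longrightarrow> r \<in> P \<Longrightarrow> le p q \<Longrightarrow> le q r \<Longrightarrow> v \<in> pm_space M p \<Longrightarrow>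
     pm_map M q r (pm_map M p q v) = pm_map M p r v"
  using pm unfolding persistence_module_def by blast

lemma map_zero: "p \<in> P \<Longrightarrow> q \<in> P \<Longrightarrow> le p q \<Longrightarrow> pm_map M p q 0 = 0"
  by (rule linear_between_zero[OF map_linear subspace_space])

text \<open>
  If the composites of the interval modules of \<open>I\<close> and \<open>J\<close> through \<open>M\<close> are non-zero in both
  directions at one point, they stay so along any path in \<open>J\<close>: a step that left \<open>I\<close> upwards would
  kill the section of \<open>I\<close>, one that left it downwards would be killed by its cosection.
\<close>

lemma interval_subset_of_pairing:
  assumes I: "I \<subseteq> P" and J: "is_interval_of P le J"
    and x: "interval_section P le M I x" and \<phi>: "interval_cosection P le M I \<phi>"
    and y: "interval_section P le M J y" and \<psi>: "interval_cosection P le M J \<psi>"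
    and p: "p \<in> I" "p \<in> J" and ne: "\<phi> p (y p) \<noteq> 0" "\<psi> p (x p) \<noteq> 0"
  shows "J \<subseteq> I"
proof
  note JP = is_interval_ofD(1)[OF J]
  fix q assume q: "q \<in> J"
  have "q \<in> I \<and> \<phi> q (y q) \<noteq> 0 \<and> \<psi> q (x q) \<noteq> 0"
    using J p(2) q
  proof (induction rule: interval_connected_induct)
    show "p \<in> I \<and> \<phi> p (y p) \<noteq> 0 \<and> \<psi> p (x p) \<noteq> 0"
      using p ne by simp
  next
    fix a b assume ab: "a \<in> J" "b \<in> J" "le a b" and "a \<in> I \<and> \<phi> a (y a) \<noteq> 0 \<and> \<psi> a (x a) \<noteq> 0"
    then have a: "a \<in> I" "\<phi> a (y a) \<noteq> 0" "\<psi> a (x a) \<noteq> 0" and P: "a \<in> P" "b \<in> P"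
      using JP by auto
    have x': "pm_map M a b (x a) = (if b \<in> I then x b else 0)"
      using interval_sectionD(2)[OF x] a ab P by simp
    have y': "pm_map M a b (y a) = y b"
      using interval_sectionD(2)[OF y] a ab P by simp
    have \<psi>': "\<psi> b (pm_map M a b (x a)) = \<psi> a (x a)"
      using interval_cosectionD(2)[OF \<psi>] a ab P interval_sectionD(1)[OF x] by simp
    have b: "b \<in> I"
      using \<psi>' x' a(3) linear_between_zero[OF interval_cosectionD(1)[OF \<psi> ab(2)] subspace_space[OF P(2)]]
      by (auto split: if_splits)
    have "\<phi> b (y b) = \<phi> a (y a)"
      using interval_cosectionD(2)[OF \<phi> P(1) b ab(3) interval_sectionD(1)[OF y ab(1)]] a(1) y' by simp
    then show "b \<in> I \<and> \<phi> b (y b) \<noteq> 0 \<and> \<psi> b (x b) \<noteq> 0"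
      using a b x' \<psi>' by simp
  next
    fix a b assume ab: "a \<in> J" "b \<in> J" "le b a" and "a \<in> I \<and> \<phi> a (y a) \<noteq> 0 \<and> \<psi> a (x a) \<noteq> 0"
    then have a: "a \<in> I" "\<phi> a (y a) \<noteq> 0" "\<psi> a (x a) \<noteq> 0" and P: "a \<in> P" "b \<in> P"
      using JP by auto
    have y': "pm_map M b a (y b) = y a"
      using interval_sectionD(2)[OF y] a ab P by simp
    have "\<phi> a (y a) = (if b \<in> I then \<phi> b (y b) else 0)"
      using interval_cosectionD(2)[OF \<phi> P(2) a(1) ab(3) interval_sectionD(1)[OF y ab(2)]] y' by simp
    then have b: "b \<in> I" "\<phi> b (y b) \<noteq> 0"
      using a by (auto split: if_splits)
    have "\<psi> a (pm_map M b a (x b)) = \<psi> b (x b)"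
      using interval_cosectionD(2)[OF \<psi> P(2) ab(1,3) interval_sectionD(1)[OF x b(1)]] ab(2) by simp
    then have "\<psi> b (x b) \<noteq> 0"
      using interval_sectionD(2)[OF x b(1) P(1) ab(3)] a by simp
    then show "b \<in> I \<and> \<phi> b (y b) \<noteq> 0 \<and> \<psi> b (x b) \<noteq> 0"
      using b by simp
  qed
  then show "q \<in> I"
    by simp
qed

lemma interval_eq_of_pairing:
  assumes "is_interval_of P le I" "is_interval_of P le J"
    and "interval_section P le M I x" "interval_cosection P le M I \<phi>"
    and "interval_section P le M J y" "interval_cosection P le M J \<psi>"
    and "p \<in> I" "p \<in> J" "\<phi> p (y p) \<noteq> 0" "\<psi> p (x p) \<noteq> 0"
  shows "I = J"
  using interval_subset_of_pairing[of I J x \<phi> y \<psi> p] interval_subset_of_pairing[of J I y \<psi> x \<phi> p]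
    assms is_interval_ofD(1) by blast

lemma section_pairing_constant:
  assumes "is_interval_of P le I" "p \<in> I" "q \<in> I"
    and x: "interval_section P le M I x" and \<phi>: "interval_cosection P le M I \<phi>"
  shows "\<phi> q (x q) = \<phi> p (x p)"
  using assms(1-3)
proof (induction rule: interval_connected_induct)
  case (up y z)
  have P: "y \<in> P" "z \<in> P"
    using up is_interval_ofD(1)[OF assms(1)] by auto
  show ?case
    using interval_cosectionD(2)[OF \<phi> P(1) up(2,3) interval_sectionD(1)[OF x up(1)]]
      interval_sectionD(2)[OF x up(1) P(2) up(3)] up by simp
next
  case (down y z)
  have P: "y \<in> P" "z \<in> P"
    using down is_interval_ofD(1)[OF assms(1)] by auto
  show ?case
    using interval_cosectionD(2)[OF \<phi> P(2) down(1,3) interval_sectionD(1)[OF x down(2)]]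
      interval_sectionD(2)[OF x down(2) P(1) down(3)] down by simp
qed (rule refl)

text \<open>Applying a map of \<open>M\<close> to the basis expansion of \<open>v\<close> either keeps or kills each term.\<close>

lemma interval_basis_cosection:
  assumes B: "interval_basis P le M A J x \<phi>" and a: "a \<in> A"
  shows "interval_cosection P le M (J a) (\<phi> a)"
  unfolding interval_cosection_def
proof (intro conjI ballI impI)
  show "linear_between (pm_scale M) (pm_space M p) (*) UNIV (\<phi> a p)" if "p \<in> J a" for p
    using interval_basisD(4)[OF B a that] .
  fix p q v assume p: "p \<in> P" and q: "q \<in> J a" and le: "le p q" and v: "v \<in> pm_space M p"
  have lin: "linear_between (pm_scale M) (pm_space M q) (*) UNIV (\<phi> a q)"
    using interval_basisD(4)[OF B a q] .
  have qP: "q \<in> P"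
    using is_interval_ofD(1)[OF interval_basisD(1)[OF B a]] q by blast
  let ?A = "{b \<in> A. p \<in> J b}"
  have sec: "interval_section P le M (J b) (x b)" if "b \<in> A" for b
    using interval_basisD(3)[OF B that] .
  have fin: "finite ?A"
    using interval_basisD(2)[OF B p] .
  have inp: "pm_scale M c (x b p) \<in> pm_space M p" if "b \<in> ?A" for b c
    using that interval_sectionD(1)[OF sec] subspace_scale[OF subspace_space[OF p]] by blast
  have "\<phi> a q (pm_map M p q v)
      = \<phi> a q (pm_map M p q (\<Sum>b\<in>?A. pm_scale M (\<phi> b p v) (x b p)))"
    by (simp only: interval_basisD(6)[OF B p v])
  also have "\<dots> = (\<Sum>b\<in>?A. \<phi> a q (pm_map M p q (pm_scale M (\<phi> b p v) (x b p))))"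
    by (rule linear_between_sum[OF linear_between_comp[OF map_linear[OF p qP le] lin] subspace_space[OF p]])
      (rule inp)
  also have "\<dots> = (\<Sum>b\<in>?A. if b = a then \<phi> b p v else 0)"
  proof (rule sum.cong[OF refl])
    fix b assume b: "b \<in> ?A"
    then have b': "b \<in> A" "p \<in> J b"
      by auto
    note xb = interval_sectionD(1)[OF sec[OF b'(1)] b'(2)]
    have "\<phi> a q (pm_map M p q (pm_scale M (\<phi> b p v) (x b p)))
      = \<phi> b p v * \<phi> a q (pm_map M p q (x b p))"
      using linear_betweenD(3)[OF linear_between_comp[OF map_linear[OF p qP le] lin] xb] .
    also have "pm_map M p q (x b p) = (if q \<in> J b then x b q else 0)"
      by (rule interval_sectionD(2)[OF sec[OF b'(1)] b'(2) qP le])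
    also have "\<phi> a q \<dots> = (if b = a then 1 else 0)"
    proof (cases "q \<in> J b")
      case True
      then show ?thesis
        using interval_basisD(5)[OF B a b'(1) q] by simp
    next
      case False
      then have "b \<noteq> a"
        using q by blast
      then show ?thesis
        using False linear_between_zero[OF lin subspace_space[OF qP]] by simp
    qed
    finally show "\<phi> a q (pm_map M p q (pm_scale M (\<phi> b p v) (x b p))) = (if b = a then \<phi> b p v else 0)"
      by simp
  qed
  also have "\<dots> = (if p \<in> J a then \<phi> a p v else 0)"
    using fin a by simp
  finally show "\<phi> a q (pm_map M p q v) = (if p \<in> J a then \<phi> a p v else 0)" .
qed

end

section \<open>Interval bases and direct sums of interval modules\<close>

lemma pm_iso_sym: "pm_iso P le M N \<Longrightarrow> pm_iso P le N M"
  unfolding pm_iso_def by blast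

lemma pm_hom_comp:
  assumes "pm_hom P le M N h" "pm_hom P le N L k"
  shows "pm_hom P le M L (\<lambda>p x. k p (h p x))"
  using assms unfolding pm_hom_def linear_between_def by simp

lemma pm_iso_trans:
  assumes "pm_iso P le M N" "pm_iso P le N L"
  shows "pm_iso P le M L"
proof -
  from assms(1) obtain h g where hg: "pm_hom P le M N h" "pm_hom P le N M g"
    "\<And>p x. p \<in> P \<Longrightarrow> x \<in> pm_space M p \<Longrightarrow> g p (h p x) = x"
    "\<And>p y. p \<in> P \<Longrightarrow> y \<in> pm_space N p \<Longrightarrow> h p (g p y) = y"
    unfolding pm_iso_def by metis
  from assms(2) obtain h' g' where hg': "pm_hom P le N L h'" "pm_hom P le L N g'"
    "\<And>p x. p \<in> P \<Longrightarrow> x \<in> pm_space N p \<Longrightarrow> g' p (h' p x) = x"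
    "\<And>p y. p \<in> P \<Longrightarrow> y \<in> pm_space L p \<Longrightarrow> h' p (g' p y) = y"
    unfolding pm_iso_def by metis
  have "h p x \<in> pm_space N p" if "p \<in> P" "x \<in> pm_space M p" for p x
    using hg(1) that unfolding pm_hom_def linear_between_def by blast
  moreover have "g' p x \<in> pm_space N p" if "p \<in> P" "x \<in> pm_space L p" for p x
    using hg'(2) that unfolding pm_hom_def linear_between_def by blast
  ultimately have "\<forall>p\<in>P. (\<forall>x\<in>pm_space M p. g p (g' p (h' p (h p x))) = x) \<and>
      (\<forall>y\<in>pm_space L p. h' p (h p (g p (g' p y))) = y)"
    using hg hg' by simp
  with pm_hom_comp[OF hg(1) hg'(1)] pm_hom_comp[OF hg'(2) hg(2)] show ?thesis
    unfolding pm_iso_def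
    by (intro exI[of _ "\<lambda>p x. h' p (h p x)"] exI[of _ "\<lambda>p x. g p (g' p x)"]) blast
qed

lemma interval_sum_space:
  assumes "finite {a \<in> A. p \<in> J a}"
  shows "pm_space (direct_sum_pm A (\<lambda>a. interval_module (J a))) p
     = {w. \<forall>a. w a \<noteq> 0 \<longrightarrow> a \<in> A \<and> p \<in> J a}"
    (is "?L = ?R")
proof -
  have "finite {a. w a \<noteq> 0}" if "w \<in> ?R" for w
    by (rule finite_subset[OF _ assms]) (use that in blast)
  moreover have "w \<in> ?L \<longleftrightarrow> finite {a. w a \<noteq> 0} \<and> w \<in> ?R" for w
    unfolding direct_sum_pm_def interval_module_def by simp blast
  ultimately show ?thesis
    by blast
qed

lemma interval_sum_scale:
  "pm_scale (direct_sum_pm A (\<lambda>a. interval_module (J a))) = (\<lambda>c w a. c * w a)"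
  unfolding direct_sum_pm_def interval_module_def by simp

lemma interval_sum_map:
  "pm_map (direct_sum_pm A (\<lambda>a. interval_module (J a))) p q w
     = (\<lambda>a. if a \<in> A \<and> p \<in> J a \<and> q \<in> J a then w a else 0)"
  unfolding direct_sum_pm_def interval_module_def by auto

context pers_module
begin

text \<open>The isomorphism takes coordinates; its inverse forms linear combinations.\<close>

lemma interval_basis_imp_iso:
  assumes B: "interval_basis P le M A J x \<phi>"
  shows "pm_iso P le M (direct_sum_pm A (\<lambda>a. interval_module (J a)))"
proof -
  let ?D = "direct_sum_pm A (\<lambda>a. interval_module (J a) :: (_, 'k, _) pmod)"
  let ?A = "\<lambda>p. {a \<in> A. p \<in> J a}"
  define h where "h p v a = (if a \<in> ?A p then \<phi> a p v else 0)" for p v a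
  define g where "g p w = (\<Sum>a\<in>?A p. pm_scale M (w a) (x a p))" for p and w :: "_ \<Rightarrow> 'k"
  note space = interval_sum_space[OF interval_basisD(2)[OF B]]
  have xin: "x a p \<in> pm_space M p" if "a \<in> ?A p" for a p
    using that interval_sectionD(1)[OF interval_basisD(3)[OF B]] by blast
  have lin: "linear_between (pm_scale M) (pm_space M p) (*) UNIV (\<phi> a p)" if "a \<in> ?A p" for a p
    using that interval_basisD(4)[OF B] by blast
  have "pm_hom P le M ?D h"
    unfolding pm_hom_def
  proof (intro conjI ballI impI)
    fix p assume p: "p \<in> P"
    show "linear_between (pm_scale M) (pm_space M p) (pm_scale ?D) (pm_space ?D p) (h p)"
      unfolding linear_between_def space[OF p] interval_sum_scale h_def
      using linear_betweenD(2,3)[OF lin[of _ p]] by (auto split: if_splits)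
    fix q v assume q: "q \<in> P" and le: "le p q" and v: "v \<in> pm_space M p"
    have "\<phi> a q (pm_map M p q v) = (if p \<in> J a then \<phi> a p v else 0)" if "a \<in> ?A q" for a
      using that interval_cosectionD(2)[OF interval_basis_cosection[OF B] p _ le v] by blast
    then show "h q (pm_map M p q v) = pm_map ?D p q (h p v)"
      unfolding interval_sum_map h_def by (intro ext) simp
  qed
  moreover have "pm_hom P le ?D M g"
    unfolding pm_hom_def
  proof (intro conjI ballI impI)
    fix p assume p: "p \<in> P"
    have "g p w \<in> pm_space M p" for w
      unfolding g_def
      by (intro subspace_sum[OF subspace_space[OF p]] subspace_scale[OF subspace_space[OF p]] xin)
    moreover have "g p (\<lambda>a. c * w a) = pm_scale M c (g p w)" for c w
      unfolding g_def by (simp add: scale_sum_right)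
    ultimately show "linear_between (pm_scale ?D) (pm_space ?D p) (pm_scale M) (pm_space M p) (g p)"
      unfolding linear_between_def interval_sum_scale
      by (simp add: g_def scale_left_distrib sum.distrib)
    fix q w assume q: "q \<in> P" and le: "le p q" and w: "w \<in> pm_space ?D p"
    have "pm_map M p q (g p w) = (\<Sum>a\<in>?A p. pm_map M p q (pm_scale M (w a) (x a p)))"
      unfolding g_def
      by (rule linear_between_sum[OF map_linear[OF p q le] subspace_space[OF p]])
        (intro subspace_scale[OF subspace_space[OF p]] xin)
    also have "\<dots> = (\<Sum>a\<in>?A p. if q \<in> J a then pm_scale M (w a) (x a q) else 0)"
    proof (rule sum.cong[OF refl])
      fix a assume a: "a \<in> ?A p"
      have "pm_map M p q (x a p) = (if q \<in> J a then x a q else 0)"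
        using a interval_sectionD(2)[OF interval_basisD(3)[OF B] _ q le] by simp
      then show "pm_map M p q (pm_scale M (w a) (x a p))
          = (if q \<in> J a then pm_scale M (w a) (x a q) else 0)"
        using linear_betweenD(3)[OF map_linear[OF p q le] xin[OF a]] by simp
    qed
    also have "\<dots> = (\<Sum>a\<in>?A p \<inter> ?A q. pm_scale M (w a) (x a q))"
      by (subst sum.inter_restrict[OF interval_basisD(2)[OF B p]]) (auto intro!: sum.cong)
    also have "\<dots> = g q (pm_map ?D p q w)"
      unfolding g_def interval_sum_map
      by (rule sum.mono_neutral_cong_left) (use interval_basisD(2)[OF B q] in auto)
    finally show "g q (pm_map ?D p q w) = pm_map M p q (g p w)" ..
  qed
  moreover have "g p (h p v) = v" if "p \<in> P" "v \<in> pm_space M p" for p v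
  proof -
    have "g p (h p v) = (\<Sum>a\<in>?A p. pm_scale M (\<phi> a p v) (x a p))"
      unfolding g_def h_def by (rule sum.cong) auto
    then show ?thesis
      using interval_basisD(6)[OF B that] by simp
  qed
  moreover have "h p (g p w) = w" if p: "p \<in> P" and w: "w \<in> pm_space ?D p" for p w
  proof
    fix a
    show "h p (g p w) a = w a"
    proof (cases "a \<in> ?A p")
      case True
      have "h p (g p w) a = (\<Sum>b\<in>?A p. \<phi> a p (pm_scale M (w b) (x b p)))"
        using True unfolding h_def g_def
        by (subst linear_between_sum[OF lin[OF True] subspace_space[OF p], symmetric])
          (auto intro!: subspace_scale[OF subspace_space[OF p]] xin)
      also have "\<dots> = (\<Sum>b\<in>?A p. if b = a then w b else 0)"
        using True linear_betweenD(3)[OF lin[OF True] xin] interval_basisD(5)[OF B]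
        by (intro sum.cong) auto
      also have "\<dots> = w a"
        using True interval_basisD(2)[OF B p] by simp
      finally show ?thesis .
    next
      case False
      then show ?thesis
        using w unfolding space[OF p] h_def by auto
    qed
  qed
  ultimately show ?thesis
    unfolding pm_iso_def by blast
qed

text \<open>
  The coordinate vectors of the direct sum give the basis.  Only finitely many intervals contain a
  given point because the space at that point is finite-dimensional.
\<close>

lemma iso_imp_interval_basis:
  fixes A :: "'i set"
  assumes J: "\<And>a. a \<in> A \<Longrightarrow> is_interval_of P le (J a)"
    and iso: "pm_iso P le M (direct_sum_pm A (\<lambda>a. interval_module (J a)))"
  shows "\<exists>x \<phi>. interval_basis P le M A J x \<phi>"
proof -
  let ?D = "direct_sum_pm A (\<lambda>a. interval_module (J a) :: (_, 'k, _) pmod)"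
  let ?A = "\<lambda>p. {a \<in> A. p \<in> J a}"
  from iso obtain h g where h: "pm_hom P le M ?D h" and g: "pm_hom P le ?D M g"
    and gh: "\<And>p v. p \<in> P \<Longrightarrow> v \<in> pm_space M p \<Longrightarrow> g p (h p v) = v"
    and hg: "\<And>p w. p \<in> P \<Longrightarrow> w \<in> pm_space ?D p \<Longrightarrow> h p (g p w) = w"
    unfolding pm_iso_def by metis
  have hlin: "linear_between (pm_scale M) (pm_space M p) (pm_scale ?D) (pm_space ?D p) (h p)"
    if "p \<in> P" for p
    using h that unfolding pm_hom_def by blast
  have glin: "linear_between (pm_scale ?D) (pm_space ?D p) (pm_scale M) (pm_space M p) (g p)"
    if "p \<in> P" for p
    using g that unfolding pm_hom_def by blast
  have gnat: "g q (pm_map ?D p q w) = pm_map M p q (g p w)"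
    if "p \<in> P" "q \<in> P" "le p q" "w \<in> pm_space ?D p" for p q w
    using g that unfolding pm_hom_def by blast
  define e where "e a b = (if b = a then 1 else 0 :: 'k)" for a b :: 'i
  define x where "x a p = g p (e a)" for a p
  define \<phi> where "\<phi> a p v = h p v a" for a p v
  have e: "e a \<in> pm_space ?D p" if "a \<in> ?A p" for a p
  proof -
    have "{b. e a b \<noteq> 0} = {a}"
      unfolding e_def by auto
    then show ?thesis
      using that unfolding direct_sum_pm_def interval_module_def by (auto simp: e_def)
  qed
  have AP: "p \<in> P" if "a \<in> ?A p" for a p
    using that J is_interval_ofD(1) by fastforce
  have xin: "x a p \<in> pm_space M p" if "a \<in> ?A p" for a p
    unfolding x_def by (rule linear_betweenD(1)[OF glin[OF AP[OF that]] e[OF that]])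
  have \<phi>lin: "linear_between (pm_scale M) (pm_space M p) (*) UNIV (\<phi> a p)" if "a \<in> ?A p" for a p
    using linear_betweenD(2,3)[OF hlin[OF AP[OF that]]]
    unfolding linear_between_def \<phi>_def interval_sum_scale by simp
  have dual: "\<phi> a p (x b p) = (if a = b then 1 else 0)" if "a \<in> ?A p" "b \<in> ?A p" for a b p
    unfolding \<phi>_def x_def hg[OF AP[OF that(2)] e[OF that(2)]] by (simp add: e_def)
  have fin: "finite (?A p)" if "p \<in> P" for p
  proof -
    obtain T where T: "finite T" "pm_space M p = span T"
      using finite_span[OF \<open>p \<in> P\<close>] by blast
    have "finite (?A p) \<and> card (?A p) \<le> card T"
      by (rule dual_family_card[OF subspace_space[OF \<open>p \<in> P\<close>], of _ "\<lambda>a. x a p" "\<lambda>a. \<phi> a p"])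
        (use xin \<phi>lin dual T(1) T(2)[symmetric] in \<open>simp_all add: span_base\<close>)
    then show ?thesis ..
  qed
  have "interval_section P le M (J a) (x a)" if a: "a \<in> A" for a
    unfolding interval_section_def
  proof (intro conjI ballI impI)
    fix p assume p: "p \<in> J a"
    then have pA: "a \<in> ?A p"
      using a by simp
    show "x a p \<in> pm_space M p"
      by (rule xin[OF pA])
    fix q assume q: "q \<in> P" and le: "le p q"
    have "pm_map ?D p q (e a) = (if q \<in> J a then e a else (\<lambda>_. 0))"
      using a p unfolding interval_sum_map by (auto simp: e_def)
    moreover have "g q (\<lambda>_. 0) = 0"
      using linear_betweenD(3)[OF glin[OF q], of "\<lambda>_. 0" 0] unfolding interval_sum_scale
      by (simp add: interval_sum_space[OF fin[OF q]])
    ultimately show "pm_map M p q (x a p) = (if q \<in> J a then x a q else 0)"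
      using gnat[OF AP[OF pA] q le e[OF pA]] unfolding x_def by (simp split: if_splits)
  qed
  moreover have "(\<Sum>a\<in>?A p. pm_scale M (\<phi> a p v) (x a p)) = v" if p: "p \<in> P" and v: "v \<in> pm_space M p" for p v
  proof -
    let ?w = "\<Sum>a\<in>?A p. pm_scale M (\<phi> a p v) (x a p)"
    have w: "?w \<in> pm_space M p"
      by (intro subspace_sum[OF subspace_space[OF p]] subspace_scale[OF subspace_space[OF p]] xin)
    have "h p ?w a = h p v a" for a
    proof (cases "a \<in> ?A p")
      case True
      have "h p ?w a = (\<Sum>b\<in>?A p. \<phi> a p (pm_scale M (\<phi> b p v) (x b p)))"
        using linear_between_sum[OF \<phi>lin[OF True] subspace_space[OF p]]
        by (subst linear_between_sum[OF \<phi>lin[OF True] subspace_space[OF p], symmetric])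
          (auto intro!: subspace_scale[OF subspace_space[OF p]] xin simp: \<phi>_def)
      also have "\<dots> = (\<Sum>b\<in>?A p. if b = a then \<phi> b p v else 0)"
        using True linear_betweenD(3)[OF \<phi>lin[OF True] xin] dual
        by (intro sum.cong) auto
      also have "\<dots> = \<phi> a p v"
        using True fin[OF p] by simp
      finally show ?thesis
        unfolding \<phi>_def .
    next
      case False
      have "h p u a = 0" if "u \<in> pm_space M p" for u
        using linear_betweenD(1)[OF hlin[OF p] that] False
        unfolding interval_sum_space[OF fin[OF p]] by blast
      then show ?thesis
        using w v by simp
    qed
    then have "h p ?w = h p v"
      by blast
    then show ?thesis
      using gh[OF p w] gh[OF p v] by simp
  qed
  ultimately have "interval_basis P le M A J x \<phi>"
    unfolding interval_basis_def using J fin \<phi>lin dual by auto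
  then show ?thesis
    by blast
qed

end

lemma interval_basis_reindex:
  assumes B: "interval_basis P le M A J x \<phi>" and f: "bij_betw f A' A"
    and K: "\<And>a. a \<in> A' \<Longrightarrow> K a = J (f a)"
  shows "interval_basis P le M A' K (\<lambda>a. x (f a)) (\<lambda>a. \<phi> (f a))"
proof -
  have fA: "f a \<in> A" if "a \<in> A'" for a
    using f that bij_betwE by blast
  have inj: "f a = f b \<longleftrightarrow> a = b" if "a \<in> A'" "b \<in> A'" for a b
    using f that unfolding bij_betw_def inj_on_def by blast
  have bij: "bij_betw f {a \<in> A'. p \<in> K a} {a \<in> A. p \<in> J a}" for p
    by (rule bij_betw_subset[OF f]) (use f K in \<open>auto simp: bij_betw_def\<close>)
  show ?thesis
    unfolding interval_basis_def
  proof (intro conjI ballI allI impI)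
    show "finite {a \<in> A'. p \<in> K a}" if "p \<in> P" for p
      using bij_betw_finite[OF bij] interval_basisD(2)[OF B that] by blast
    show "v = (\<Sum>a\<in>{a \<in> A'. p \<in> K a}. pm_scale M (\<phi> (f a) p v) (x (f a) p))"
      if "p \<in> P" "v \<in> pm_space M p" for p v
      using sum.reindex_bij_betw[OF bij, of "\<lambda>a. pm_scale M (\<phi> a p v) (x a p)" p]
        interval_basisD(6)[OF B that] by simp
  qed (use interval_basisD(1,3-5)[OF B] fA K inj in simp_all)
qed

context pers_module
begin

lemma interval_decomposition_iff_basis:
  "is_interval_decomposition P le M \<mu> \<longleftrightarrow> (\<exists>x \<phi>. interval_basis P le M {(I, j). j < \<mu> I} fst x \<phi>)"
proof -
  let ?A = "{(I, j). j < \<mu> I}"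
  have fam: "(\<lambda>(I, j). interval_module I) = (\<lambda>a. interval_module (fst a) :: (_, 'k, _) pmod)"
    by (auto simp: fun_eq_iff)
  have int: "(\<forall>I\<in>occurring \<mu>. is_interval_of P le I) \<longleftrightarrow> (\<forall>a\<in>?A. is_interval_of P le (fst a))"
    by (auto simp: occurring_def)
  show ?thesis
    unfolding is_interval_decomposition_def fam int
  proof
    assume "(\<forall>a\<in>?A. is_interval_of P le (fst a)) \<and>
      pm_iso P le M (direct_sum_pm ?A (\<lambda>a. interval_module (fst a)))"
    then show "\<exists>x \<phi>. interval_basis P le M ?A fst x \<phi>"
      by (intro iso_imp_interval_basis) blast+
  next
    assume "\<exists>x \<phi>. interval_basis P le M ?A fst x \<phi>"
    then obtain x \<phi> where B: "interval_basis P le M ?A fst x \<phi>"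
      by blast
    show "(\<forall>a\<in>?A. is_interval_of P le (fst a)) \<and>
      pm_iso P le M (direct_sum_pm ?A (\<lambda>a. interval_module (fst a)))"
      using interval_basisD(1)[OF B] interval_basis_imp_iso[OF B] by blast
  qed
qed

lemma finite_copies:
  assumes B: "interval_basis P le M A J x \<phi>"
  shows "finite {a \<in> A. J a = I}"
proof (cases "{a \<in> A. J a = I} = {}")
  case False
  then obtain a where a: "a \<in> A" "J a = I"
    by blast
  then obtain p where p: "p \<in> I" "p \<in> P"
    using is_interval_ofD(1,2)[OF interval_basisD(1)[OF B a(1)]] by blast
  show ?thesis
    by (rule finite_subset[OF _ interval_basisD(2)[OF B p(2)]]) (use p in auto)
qed (metis finite.emptyI)

lemma interval_basis_imp_decomposition:
  assumes B: "interval_basis P le M A J x \<phi>"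
  shows "is_interval_decomposition P le M (\<lambda>I. card {a \<in> A. J a = I})"
proof -
  let ?\<mu> = "\<lambda>I. card {a \<in> A. J a = I}"
  have "\<exists>f. bij_betw f {..<?\<mu> I} {a \<in> A. J a = I}" for I
    using ex_bij_betw_nat_finite[OF finite_copies[OF B]] by (simp add: atLeast0LessThan)
  then obtain f where f: "\<And>I. bij_betw (f I) {..<?\<mu> I} {a \<in> A. J a = I}"
    by metis
  have fJ: "f I j \<in> A \<and> J (f I j) = I" if "j < ?\<mu> I" for I j
    using bij_betwE[OF f[of I]] that by auto
  have bij: "bij_betw (\<lambda>(I, j). f I j) {(I, j). j < ?\<mu> I} A"
    unfolding bij_betw_def
  proof
    show "inj_on (\<lambda>(I, j). f I j) {(I, j). j < ?\<mu> I}"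
    proof (rule inj_onI, clarsimp)
      fix I j I' j' assume *: "j < ?\<mu> I" "j' < ?\<mu> I'" "f I j = f I' j'"
      then have "I = I'"
        using fJ by metis
      then show "I = I' \<and> j = j'"
        using * bij_betw_imp_inj_on[OF f[of I]] by (auto simp: inj_on_def)
    qed
    have "\<exists>j<?\<mu> (J a). f (J a) j = a" if "a \<in> A" for a
    proof -
      have "a \<in> f (J a) ` {..<?\<mu> (J a)}"
        unfolding bij_betw_imp_surj_on[OF f[of "J a"]] using that by simp
      then show ?thesis
        by auto
    qed
    then show "(\<lambda>(I, j). f I j) ` {(I, j). j < ?\<mu> I} = A"
      using fJ by (auto simp: image_iff) metis
  qed
  have "fst a = J ((\<lambda>(I, j). f I j) a)" if "a \<in> {(I, j). j < ?\<mu> I}" for a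
    using that fJ by auto
  note interval_basis_reindex[OF B bij this]
  then show ?thesis
    unfolding interval_decomposition_iff_basis by blast
qed

text \<open>
  Fix a point \<open>p\<close> of \<open>I\<close> and the span of the \<open>y b p\<close> with \<open>K b = I\<close>.  The components in it of the
  \<open>x a p\<close> with \<open>J a = I\<close> still have the \<open>\<phi> a p\<close> as dual functionals, since the intervals
  \<open>K b \<noteq> I\<close> do not contribute to the pairing.
\<close>

lemma card_copies_le:
  assumes B: "interval_basis P le M A J x \<phi>" and C: "interval_basis P le M B K y \<psi>"
  shows "card {a \<in> A. J a = I} \<le> card {b \<in> B. K b = I}"
proof (cases "{a \<in> A. J a = I} = {}")
  case False
  let ?A = "{a \<in> A. J a = I}" and ?B = "{b \<in> B. K b = I}"
  from False have I: "is_interval_of P le I"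
    using interval_basisD(1)[OF B] by blast
  then obtain p where p: "p \<in> I" "p \<in> P"
    using is_interval_ofD(1,2) by blast
  note sub = subspace_space[OF p(2)]
  let ?Bp = "{b \<in> B. p \<in> K b}"
  have yin: "y b p \<in> pm_space M p" if "b \<in> ?Bp" for b
    using interval_sectionD(1)[OF interval_basisD(3)[OF C]] that by blast
  have xin: "x a p \<in> pm_space M p" if "a \<in> ?A" for a
    using interval_sectionD(1)[OF interval_basisD(3)[OF B]] p that by blast
  have BBp: "?B \<subseteq> ?Bp"
    using p by auto
  define u where "u a = (\<Sum>b\<in>?B. pm_scale M (\<psi> b p (x a p)) (y b p))" for a
  have lin: "linear_between (pm_scale M) (pm_space M p) (*) UNIV (\<phi> a p)" if "a \<in> ?A" for a
    using interval_basisD(4)[OF B] that p by blast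
  have dual: "\<phi> a p (u a') = (if a = a' then 1 else 0)" if a: "a \<in> ?A" "a' \<in> ?A" for a a'
  proof -
    have val: "\<phi> a p (\<Sum>b\<in>S. pm_scale M (\<psi> b p (x a' p)) (y b p))
        = (\<Sum>b\<in>S. \<psi> b p (x a' p) * \<phi> a p (y b p))" if "S \<subseteq> ?Bp" for S
      using that linear_betweenD(3)[OF lin[OF a(1)] yin]
      by (subst linear_between_sum[OF lin[OF a(1)] sub])
        (auto intro!: subspace_scale[OF sub] yin sum.cong)
    have "\<phi> a p (u a') = (\<Sum>b\<in>?B. \<psi> b p (x a' p) * \<phi> a p (y b p))"
      unfolding u_def by (rule val[OF BBp])
    also have "\<dots> = (\<Sum>b\<in>?Bp. \<psi> b p (x a' p) * \<phi> a p (y b p))"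
    proof (rule sum.mono_neutral_left[OF interval_basisD(2)[OF C p(2)] BBp], rule ballI)
      fix b assume b: "b \<in> ?Bp - ?B"
      show "\<psi> b p (x a' p) * \<phi> a p (y b p) = 0"
      proof (rule ccontr)
        assume "\<psi> b p (x a' p) * \<phi> a p (y b p) \<noteq> 0"
        then have ne: "\<psi> b p (x a' p) \<noteq> 0" "\<phi> a p (y b p) \<noteq> 0"
          by auto
        have aA: "a \<in> A" "J a = I" "a' \<in> A" "J a' = I" and bB: "b \<in> B" "p \<in> K b"
          using a b by auto
        have sec: "interval_section P le M I (x a')"
          using interval_basisD(3)[OF B aA(3)] aA(4) by simp
        have cosec: "interval_cosection P le M I (\<phi> a)"
          using interval_basis_cosection[OF B aA(1)] aA(2) by simp
        have "I = K b"
          by (rule interval_eq_of_pairing[OF I interval_basisD(1)[OF C bB(1)] sec cosec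
              interval_basisD(3)[OF C bB(1)] interval_basis_cosection[OF C bB(1)], of p])
            (fact p bB ne)+
        then show False
          using b by blast
      qed
    qed
    also have "\<dots> = \<phi> a p (\<Sum>b\<in>?Bp. pm_scale M (\<psi> b p (x a' p)) (y b p))"
      by (rule val[symmetric]) simp
    also have "\<dots> = \<phi> a p (x a' p)"
      unfolding interval_basisD(6)[OF C p(2) xin[OF a(2)]] ..
    also have "\<dots> = (if a = a' then 1 else 0)"
      using interval_basisD(5)[OF B] a p by auto
    finally show ?thesis .
  qed
  have "finite ?A \<and> card ?A \<le> card ((\<lambda>b. y b p) ` ?B)"
  proof (rule dual_family_card[OF sub, of _ u "\<lambda>a. \<phi> a p"])
    show "u a \<in> pm_space M p" if "a \<in> ?A" for a
      unfolding u_def using BBp by (intro subspace_sum[OF sub] subspace_scale[OF sub] yin) blast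
    show "u a \<in> span ((\<lambda>b. y b p) ` ?B)" if "a \<in> ?A" for a
      unfolding u_def by (intro span_sum span_scale span_base) blast
  qed (use lin dual finite_copies[OF C] in auto)
  then have "card ?A \<le> card ((\<lambda>b. y b p) ` ?B)"
    by (rule conjunct2)
  also have "\<dots> \<le> card ?B"
    by (rule card_image_le[OF finite_copies[OF C]])
  finally show ?thesis .
qed (simp only: card.empty)

lemma decomposition_unique:
  assumes "is_interval_decomposition P le M \<mu>" "is_interval_decomposition P le M \<nu>"
  shows "\<mu> = \<nu>"
proof -
  have copies: "{a \<in> {(I, j). j < \<kappa> I}. fst a = I} = {I} \<times> {..<\<kappa> I}" for I and \<kappa> :: "'p set \<Rightarrow> nat"
    by auto
  from assms obtain x \<phi> y \<psi>
    where B: "interval_basis P le M {(I, j). j < \<mu> I} fst x \<phi>"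
      and C: "interval_basis P le M {(I, j). j < \<nu> I} fst y \<psi>"
    unfolding interval_decomposition_iff_basis by blast
  have "\<mu> I = \<nu> I" for I
    using card_copies_le[OF B C, of I] card_copies_le[OF C B, of I] unfolding copies by simp
  then show ?thesis
    by blast
qed

lemma interval_multiset_eq:
  assumes "is_interval_decomposition P le M \<mu>"
  shows "interval_multiset P le M = \<mu>"
  unfolding interval_multiset_def using assms decomposition_unique by blast

end

lemma decomposition_iso:
  assumes "pm_iso P le M N"
  shows "is_interval_decomposition P le M \<mu> \<longleftrightarrow> is_interval_decomposition P le N \<mu>"
  unfolding is_interval_decomposition_def
  using pm_iso_trans[OF assms] pm_iso_trans[OF pm_iso_sym[OF assms]] by blast

section \<open>Splitting off interval summands\<close>

definition cosection_kernel ::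
  "('p, 'k::field, 'v::ab_group_add) pmod \<Rightarrow> 'p set \<Rightarrow> ('p \<Rightarrow> 'v \<Rightarrow> 'k) \<Rightarrow> ('p, 'k, 'v) pmod" where
  "cosection_kernel M I \<phi>
     = M\<lparr>pm_space := \<lambda>p. {v \<in> pm_space M p. p \<in> I \<longrightarrow> \<phi> p v = 0}\<rparr>"

lemma cosection_kernel_simps [simp]:
  "pm_scale (cosection_kernel M I \<phi>) = pm_scale M"
  "pm_map (cosection_kernel M I \<phi>) = pm_map M"
  "pm_space (cosection_kernel M I \<phi>) p = {v \<in> pm_space M p. p \<in> I \<longrightarrow> \<phi> p v = 0}"
  unfolding cosection_kernel_def by simp_all

context pers_module
begin

lemma persistence_module_cosection_kernel:
  assumes \<phi>: "interval_cosection P le M I \<phi>"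
  shows "persistence_module P le (cosection_kernel M I \<phi>)"
  unfolding persistence_module_def cosection_kernel_simps
proof (intro conjI ballI impI)
  show "vector_space (pm_scale M)"
    by (rule vector_space_axioms)
  fix p assume p: "p \<in> P"
  let ?K = "{v \<in> pm_space M p. p \<in> I \<longrightarrow> \<phi> p v = 0}"
  have K: "subspace ?K"
  proof (cases "p \<in> I")
    case True
    then show ?thesis
      using subspace_linear_between_kernel[OF interval_cosectionD(1)[OF \<phi> True] subspace_space[OF p]
          vector_space_field] by simp
  qed (use subspace_space[OF p] in simp)
  obtain T where T: "finite T" "pm_space M p = span T"
    using finite_span[OF p] by blast
  obtain B where B: "B \<subseteq> ?K" "independent B" "?K \<subseteq> span B"
    using maximal_independent_subset[of ?K] by blast
  have "finite B"
    using independent_span_bound[OF T(1) B(2)] B(1) T(2) by blast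
  then show "\<exists>A. finite A \<and> ?K = span A"
    using B K by (metis span_minimal subset_antisym)
  fix q assume q: "q \<in> P" and le: "le p q"
  show "linear_between (pm_scale M) ?K (pm_scale M) {v \<in> pm_space M q. q \<in> I \<longrightarrow> \<phi> q v = 0} (pm_map M p q)"
    using linear_betweenD[OF map_linear[OF p q le]] interval_cosectionD(2)[OF \<phi> p _ le]
    by (simp add: linear_between_def)
qed (use map_id map_comp in auto)

text \<open>
  The space at \<open>p \<in> I\<close> is the direct sum of the line spanned by \<open>x p\<close> and the kernel of \<open>\<phi> p\<close>.  The
  coordinates of the kernel are extended to \<open>M\<close> by the projection along \<open>x p\<close>.
\<close>

lemma interval_basis_insert:
  assumes I: "is_interval_of P le I"
    and x: "interval_section P le M I x" and \<phi>: "interval_cosection P le M I \<phi>"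
    and one: "\<And>p. p \<in> I \<Longrightarrow> \<phi> p (x p) = 1"
    and B: "interval_basis P le (cosection_kernel M I \<phi>) A J y \<psi>" and c: "c \<notin> A"
  shows "interval_basis P le M (insert c A) (J(c := I)) (y(c := x))
    (\<lambda>a p v. if a = c then \<phi> p v
       else \<psi> a p (v - (if p \<in> I then pm_scale M (\<phi> p v) (x p) else 0)))"
    (is "interval_basis P le M ?A ?J ?y ?\<psi>")
proof -
  interpret K: pers_module P le "cosection_kernel M I \<phi>"
    by (unfold_locales) (rule persistence_module_cosection_kernel[OF \<phi>])
  let ?K = "pm_space (cosection_kernel M I \<phi>)"
  let ?A' = "\<lambda>p. {a \<in> A. p \<in> J a}"
  define \<pi> where "\<pi> p v = v - (if p \<in> I then pm_scale M (\<phi> p v) (x p) else 0)" for p v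
  have IP: "I \<subseteq> P"
    by (rule is_interval_ofD(1)[OF I])
  note xin = interval_sectionD(1)[OF x] and \<phi>lin = interval_cosectionD(1)[OF \<phi>]
  have \<pi>lin: "linear_between (pm_scale M) (pm_space M p) (pm_scale M) (?K p) (\<pi> p)" if p: "p \<in> P" for p
  proof (cases "p \<in> I")
    case True
    have sc: "pm_scale M c (x p) \<in> pm_space M p" for c
      by (rule subspace_scale[OF subspace_space[OF p] xin[OF True]])
    have "\<phi> p (v - pm_scale M (\<phi> p v) (x p)) = 0" if "v \<in> pm_space M p" for v
      using linear_between_diff[OF \<phi>lin[OF True] subspace_space[OF p] that sc]
        linear_betweenD(3)[OF \<phi>lin[OF True] xin[OF True]] one[OF True] by simp
    then show ?thesis
      using True linear_betweenD[OF \<phi>lin[OF True]] subspace_diff[OF subspace_space[OF p] _ sc]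
      by (simp add: linear_between_def \<pi>_def scale_left_distrib scale_right_diff_distrib)
  qed (simp add: linear_between_def \<pi>_def)
  have \<pi>K: "\<pi> p v = v" if "v \<in> ?K p" for p v
    using that by (simp add: \<pi>_def)
  have yK: "y a p \<in> ?K p" if "a \<in> A" "p \<in> J a" for a p
    by (rule interval_sectionD(1)[OF interval_basisD(3)[OF B that(1)] that(2)])
  have JP: "p \<in> P" if "a \<in> A" "p \<in> J a" for a p
    using that is_interval_ofD(1)[OF interval_basisD(1)[OF B]] by blast
  have \<psi>: "?\<psi> = (\<lambda>a p v. if a = c then \<phi> p v else \<psi> a p (\<pi> p v))"
    unfolding \<pi>_def ..
  have A': "{a \<in> ?A. p \<in> ?J a} = (if p \<in> I then insert c (?A' p) else ?A' p)" for p
    using c by auto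
  show ?thesis
    unfolding interval_basis_def \<psi>
  proof (intro conjI ballI allI impI)
    fix a assume a: "a \<in> ?A"
    show "is_interval_of P le (?J a)"
      using a I interval_basisD(1)[OF B] by auto
    show "interval_section P le M (?J a) (?y a)"
    proof (cases "a = c")
      case False
      then show ?thesis
        using a interval_basisD(3)[OF B, of a] by (simp add: interval_section_def)
    qed (simp add: x)
    show "linear_between (pm_scale M) (pm_space M p) (*) UNIV
        ((\<lambda>v. if a = c then \<phi> p v else \<psi> a p (\<pi> p v)))" if p: "p \<in> ?J a" for p
    proof (cases "a = c")
      case False
      then have aA: "a \<in> A" "p \<in> J a"
        using a p by auto
      show ?thesis
        using False linear_between_comp[OF \<pi>lin[OF JP[OF aA]]] interval_basisD(4)[OF B aA] by simp
    qed (use p \<phi>lin in simp)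
    fix b p assume b: "b \<in> ?A" and p: "p \<in> ?J a" "p \<in> ?J b"
    show "(if a = c then \<phi> p (?y b p) else \<psi> a p (\<pi> p (?y b p))) = (if a = b then 1 else 0)"
    proof (cases "a = c")
      case True
      then show ?thesis
        using one p b yK[of b p] by (auto split: if_splits)
    next
      case False
      then have aA: "a \<in> A" "p \<in> J a"
        using a p by auto
      show ?thesis
      proof (cases "b = c")
        case True
        then have "\<pi> p (?y b p) = 0"
          using p one by (simp add: \<pi>_def)
        then show ?thesis
          using False True K.linear_between_zero[OF interval_basisD(4)[OF B aA] K.subspace_space[OF JP[OF aA]]]
          by simp
      next
        case b': False
        then show ?thesis
          using False b p interval_basisD(5)[OF B aA(1), of b p] aA \<pi>K[OF yK[of b p]] by simp
      qed
    qed
  next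
    fix p assume p: "p \<in> P"
    note fin = interval_basisD(2)[OF B p]
    show "finite {a \<in> ?A. p \<in> ?J a}"
      unfolding A' using fin by simp
    fix v assume v: "v \<in> pm_space M p"
    let ?f = "\<lambda>a. pm_scale M (if a = c then \<phi> p v else \<psi> a p (\<pi> p v)) (?y a p)"
    have "(\<Sum>a\<in>?A' p. ?f a) = (\<Sum>a\<in>?A' p. pm_scale M (\<psi> a p (\<pi> p v)) (y a p))"
      using c by (intro sum.cong) auto
    also have "\<dots> = \<pi> p v"
      using interval_basisD(6)[OF B p linear_betweenD(1)[OF \<pi>lin[OF p] v]] by simp
    finally have s: "(\<Sum>a\<in>?A' p. ?f a) = \<pi> p v" .
    show "v = (\<Sum>a\<in>{a \<in> ?A. p \<in> ?J a}. ?f a)"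
    proof (cases "p \<in> I")
      case True
      have "(\<Sum>a\<in>insert c (?A' p). ?f a) = ?f c + (\<Sum>a\<in>?A' p. ?f a)"
        by (rule sum.insert[OF fin]) (use c in simp)
      then show ?thesis
        unfolding A' s using True by (simp add: \<pi>_def)
    next
      case False
      then show ?thesis
        unfolding A' using s by (simp add: \<pi>_def)
    qed
  qed
qed

end

definition has_interval_summand ::
  "'p set \<Rightarrow> ('p \<Rightarrow> 'p \<Rightarrow> bool) \<Rightarrow> ('p, 'k::field, 'v::ab_group_add) pmod \<Rightarrow> bool" where
  "has_interval_summand P le M \<longleftrightarrow>
     (\<exists>I x \<phi> p. is_interval_of P le I \<and> interval_section P le M I x \<and>
        interval_cosection P le M I \<phi> \<and> p \<in> I \<and> \<phi> p (x p) = 1)"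

text \<open>
  Splitting off summands as long as the module is non-zero ends after finitely many steps because
  the total dimension drops.
\<close>

lemma interval_basis_exists:
  fixes M :: "('p, 'k::field, 'v::ab_group_add) pmod"
  assumes P: "finite P"
    and summand: "\<And>M :: ('p, 'k, 'v) pmod. persistence_module P le M \<Longrightarrow>
       \<exists>p\<in>P. pm_space M p \<noteq> {0} \<Longrightarrow> has_interval_summand P le M"
    and M: "persistence_module P le M"
  shows "\<exists>(k::nat) J x \<phi>. interval_basis P le M {..<k} J x \<phi>"
  using M
proof (induction "\<Sum>p\<in>P. vector_space.dim (pm_scale M) (pm_space M p)" arbitrary: M rule: less_induct)
  case less
  interpret pers_module P le M
    by unfold_locales (rule less.prems)
  show ?case
  proof (cases "\<exists>p\<in>P. pm_space M p \<noteq> {0}")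
    case False
    then have "interval_basis P le M {..<0::nat} J x \<phi>" for J x \<phi>
      unfolding interval_basis_def by auto
    then show ?thesis
      by blast
  next
    case True
    from summand[OF less.prems True] obtain I x \<phi> p
      where I: "is_interval_of P le I" and x: "interval_section P le M I x"
        and \<phi>: "interval_cosection P le M I \<phi>" and p: "p \<in> I" "\<phi> p (x p) = 1"
      unfolding has_interval_summand_def by blast
    have one: "\<phi> q (x q) = 1" if "q \<in> I" for q
      using section_pairing_constant[OF I p(1) that x \<phi>] p(2) by simp
    let ?N = "cosection_kernel M I \<phi>"
    have N: "persistence_module P le ?N"
      by (rule persistence_module_cosection_kernel[OF \<phi>])
    interpret N: pers_module P le ?N
      by unfold_locales (rule N)
    have sub: "subspace (pm_space ?N q)" if "q \<in> P" for q
      using N.subspace_space[OF that] by simp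
    have less: "dim (pm_space ?N q) < dim (pm_space M q)" if "q \<in> I" for q
    proof -
      have q: "q \<in> P"
        using that is_interval_ofD(1)[OF I] by blast
      from finite_span[OF q] obtain T where T: "finite T" "pm_space M q = span T"
        by blast
      show ?thesis
      proof (rule dim_less_finite[OF sub[OF q] _ _ T(1)])
        show "x q \<in> pm_space M q" "x q \<notin> pm_space ?N q"
          using interval_sectionD(1)[OF x that] that one[OF that] by auto
      qed (use T in auto)
    qed
    have "dim (pm_space ?N q) \<le> dim (pm_space M q)" for q
      using less[of q] by (cases "q \<in> I") (auto intro: less_imp_le)
    with less have "(\<Sum>q\<in>P. dim (pm_space ?N q)) < (\<Sum>q\<in>P. dim (pm_space M q))"
      using is_interval_ofD(1)[OF I] p(1) by (intro sum_strict_mono_ex1[OF P]) blast+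
    then obtain k :: nat and J y \<psi> where B: "interval_basis P le ?N {..<k} J y \<psi>"
      using less.hyps[OF _ N] by auto
    have "insert k {..<k} = {..<Suc k}"
      by auto
    then show ?thesis
      using interval_basis_insert[OF I x \<phi> one B, of k] by auto
  qed
qed

section \<open>Existence of interval summands\<close>

lemma is_interval_of_centre:
  assumes "I \<subseteq> P" and "c \<in> I" and "\<And>q. q \<in> I \<Longrightarrow> le c q \<or> le q c"
    and "\<And>p q z. p \<in> I \<Longrightarrow> q \<in> I \<Longrightarrow> z \<in> P \<Longrightarrow> le p z \<Longrightarrow> le z q \<Longrightarrow> z \<in> I"
  shows "is_interval_of P le I"
proof -
  let ?R = "{(x, y). x \<in> I \<and> y \<in> I \<and> (le x y \<or> le y x)}"
  have "(p, q) \<in> ?R\<^sup>*" if "p \<in> I" "q \<in> I" for p q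
    using assms(2,3) that by (intro rtrancl_trans[of p c ?R q] r_into_rtrancl) auto
  then show ?thesis
    unfolding is_interval_of_def using assms by blast
qed

locale ordered_pers_module = pers_module +
  assumes le_refl: "p \<in> P \<Longrightarrow> le p p"
    and le_trans: "p \<in> P \<Longrightarrow> q \<in> P \<Longrightarrow> r \<in> P \<Longrightarrow> le p q \<Longrightarrow> le q r \<Longrightarrow> le p r"
begin

lemma map_functional_linear:
  assumes "q \<in> P" "r \<in> P" "le q r" "linear_between (pm_scale M) UNIV (*) UNIV \<rho>"
  shows "linear_between (pm_scale M) (pm_space M q) (*) UNIV (\<lambda>v. \<rho> (pm_map M q r v))"
  by (rule linear_between_comp[OF linear_between_mono[OF map_linear[OF assms(1-3)] order_refl subset_UNIV] assms(4)])

text \<open>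
  The interval is \<open>{q. p \<le> q \<le> s}\<close>: the section pushes \<open>x\<close> forward from \<open>p\<close>, the cosection pulls a
  functional back from \<open>s\<close>.
\<close>

lemma summand_between:
  assumes P: "p \<in> P" "s \<in> P" "le p s" and x: "x \<in> pm_space M p" "pm_map M p s x \<noteq> 0"
    and up: "\<And>q. q \<in> P \<Longrightarrow> le p q \<Longrightarrow> le q s \<or> pm_map M p q x = 0"
    and down: "\<And>q. q \<in> P \<Longrightarrow> le q s \<Longrightarrow> le p q \<or> pm_space M q = {0}"
  shows "has_interval_summand P le M"
proof -
  define I where "I = {q \<in> P. le p q \<and> le q s}"
  from functional_separating[of "{0}" "pm_map M p s x"] x(2)
  obtain \<psi> where \<psi>: "linear_between (pm_scale M) UNIV (*) UNIV \<psi>" "\<psi> (pm_map M p s x) = 1"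
    by auto
  have \<psi>0: "\<psi> 0 = 0"
    using linear_between_zero[OF \<psi>(1)] by simp
  have "is_interval_of P le I"
    unfolding I_def
    by (rule is_interval_of_centre[of _ _ p]) (use P le_refl le_trans[of p] le_trans[of _ _ s] in blast)+
  moreover have "interval_section P le M I (\<lambda>q. pm_map M p q x)"
    unfolding interval_section_def
  proof (intro conjI ballI impI)
    show "pm_map M p q x \<in> pm_space M q" if "q \<in> I" for q
      using that map_in[OF P(1) _ _ x(1)] by (simp add: I_def)
    fix q r assume qr: "q \<in> I" "r \<in> P" "le q r"
    then have q: "q \<in> P" "le p q"
      by (auto simp: I_def)
    have "le p r"
      by (rule le_trans[OF P(1) q(1) qr(2) q(2) qr(3)])
    then show "pm_map M q r (pm_map M p q x) = (if r \<in> I then pm_map M p r x else 0)"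
      using map_comp[OF P(1) q(1) qr(2) q(2) qr(3) x(1)] up[OF qr(2)] qr(2) by (auto simp: I_def)
  qed
  moreover have "interval_cosection P le M I (\<lambda>q v. \<psi> (pm_map M q s v))"
    unfolding interval_cosection_def
  proof (intro conjI ballI impI)
    show "linear_between (pm_scale M) (pm_space M q) (*) UNIV (\<lambda>v. \<psi> (pm_map M q s v))"
      if "q \<in> I" for q
      using that map_functional_linear[OF _ P(2) _ \<psi>(1)] by (simp add: I_def)
    fix r q v assume rq: "r \<in> P" "q \<in> I" "le r q" "v \<in> pm_space M r"
    then have q: "q \<in> P" "le p q" "le q s"
      by (auto simp: I_def)
    have rs: "le r s"
      using le_trans[OF rq(1) q(1) P(2) rq(3) q(3)] .
    have "v = 0" if "r \<notin> I"
      using that rq down[OF rq(1) rs] rs by (auto simp: I_def)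
    then show "\<psi> (pm_map M q s (pm_map M r q v)) = (if r \<in> I then \<psi> (pm_map M r s v) else 0)"
      using map_comp[OF rq(1) q(1) P(2) rq(3) q(3) rq(4)] map_zero[OF rq(1) P(2) rs] \<psi>0 by auto
  qed
  moreover have "p \<in> I"
    using P le_refl by (simp add: I_def)
  moreover have "\<psi> (pm_map M p s (pm_map M p p x)) = 1"
    using map_id[OF P(1) x(1)] \<psi>(2) by simp
  ultimately show ?thesis
    unfolding has_interval_summand_def by blast
qed

text \<open>
  A summand on \<open>I = {q. q \<le> s \<or> q \<le> t}\<close> needs functionals at \<open>s\<close> and \<open>t\<close> with the same pull-back
  to the minimum \<open>b\<close>.  The one at \<open>t\<close> can be chosen freely; the one at \<open>s\<close> then exists because
  the space at \<open>b\<close> embeds into that at \<open>s\<close>.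
\<close>

lemma summand_below:
  assumes b: "b \<in> P" "\<And>q. q \<in> P \<Longrightarrow> le b q"
    and st: "s \<in> P" "t \<in> P" "\<And>q. q \<in> P \<Longrightarrow> le q s \<Longrightarrow> le q t \<Longrightarrow> q = b"
    and inj: "\<And>v. v \<in> pm_space M b \<Longrightarrow> pm_map M b s v = 0 \<Longrightarrow> v = 0"
    and x: "x \<in> pm_space M b" "pm_map M b t x \<noteq> 0"
    and vanish: "\<And>q. q \<in> P \<Longrightarrow> le q s \<or> le q t \<or> pm_map M b q x = 0"
  shows "has_interval_summand P le M"
proof -
  define I where "I = {q \<in> P. le q s \<or> le q t}"
  have bs: "le b s" "le b t"
    using b(2) st(1,2) by blast+
  note subb = subspace_space[OF b(1)]
  from functional_separating[of "{0}" "pm_map M b t x"] x(2)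
  obtain \<tau> where \<tau>: "linear_between (pm_scale M) UNIV (*) UNIV \<tau>" "\<tau> (pm_map M b t x) = 1"
    by auto
  note lin = map_functional_linear
  have "inj_on (pm_map M b s) (pm_space M b)"
  proof (rule inj_onI)
    fix v w assume vw: "v \<in> pm_space M b" "w \<in> pm_space M b" "pm_map M b s v = pm_map M b s w"
    then have "pm_map M b s (v - w) = 0"
      using linear_between_diff[OF map_linear[OF b(1) st(1) bs(1)] subb] by simp
    then show "v = w"
      using inj[OF subspace_diff[OF subb vw(1,2)]] by simp
  qed
  from functional_extension[OF subb map_linear[OF b(1) st(1) bs(1)] this lin[OF b(1) st(2) bs(2) \<tau>(1)]]
  obtain \<sigma> where \<sigma>: "linear_between (pm_scale M) UNIV (*) UNIV \<sigma>"
    "\<And>v. v \<in> pm_space M b \<Longrightarrow> \<sigma> (pm_map M b s v) = \<tau> (pm_map M b t v)"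
    by blast
  have bI: "b \<in> I"
    using b bs by (simp add: I_def)
  define \<phi> where "\<phi> q v = (if le q s then \<sigma> (pm_map M q s v) else \<tau> (pm_map M q t v))" for q v
  have "is_interval_of P le I"
  proof (rule is_interval_of_centre[OF _ bI])
    show "I \<subseteq> P" "\<And>q. q \<in> I \<Longrightarrow> le b q \<or> le q b"
      using b(2) by (auto simp: I_def)
    fix p q z assume "p \<in> I" and q: "q \<in> I" and z: "z \<in> P" "le z q"
    then have "q \<in> P"
      by (simp add: I_def)
    then show "z \<in> I"
      using le_trans[OF z(1) _ st(1) z(2)] le_trans[OF z(1) _ st(2) z(2)] z(1) q by (auto simp: I_def)
  qed
  moreover have "interval_section P le M I (\<lambda>q. pm_map M b q x)"
    unfolding interval_section_def
  proof (intro conjI ballI impI)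
    show "pm_map M b q x \<in> pm_space M q" if "q \<in> I" for q
      using that map_in[OF b(1) _ b(2) x(1)] by (simp add: I_def)
    fix q r assume qr: "q \<in> I" "r \<in> P" "le q r"
    then have q: "q \<in> P"
      by (simp add: I_def)
    show "pm_map M q r (pm_map M b q x) = (if r \<in> I then pm_map M b r x else 0)"
      using map_comp[OF b(1) q qr(2) b(2)[OF q] qr(3) x(1)] vanish[OF qr(2)] qr(2) by (auto simp: I_def)
  qed
  moreover have "interval_cosection P le M I \<phi>"
    unfolding interval_cosection_def
  proof (intro conjI ballI impI)
    show "linear_between (pm_scale M) (pm_space M q) (*) UNIV (\<phi> q)" if "q \<in> I" for q
    proof (cases "le q s")
      case True
      then show ?thesis
        unfolding \<phi>_def using that lin[OF _ st(1) True \<sigma>(1)] by (simp add: I_def)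
    next
      case False
      then show ?thesis
        unfolding \<phi>_def using that lin[OF _ st(2) _ \<tau>(1)] by (simp add: I_def)
    qed
    fix q r v assume qr: "q \<in> P" "r \<in> I" "le q r" "v \<in> pm_space M q"
    then have r: "r \<in> P"
      by (simp add: I_def)
    show "\<phi> r (pm_map M q r v) = (if q \<in> I then \<phi> q v else 0)"
    proof (cases "le r s")
      case True
      have "le q s"
        by (rule le_trans[OF qr(1) r st(1) qr(3) True])
      then show ?thesis
        using True qr map_comp[OF qr(1) r st(1) qr(3) True qr(4)] by (simp add: \<phi>_def I_def)
    next
      case False
      then have rt: "le r t"
        using qr(2) by (simp add: I_def)
      have qt: "le q t"
        by (rule le_trans[OF qr(1) r st(2) qr(3) rt])
      have "\<sigma> (pm_map M q s v) = \<tau> (pm_map M q t v)" if "le q s"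
        using st(3)[OF qr(1) that qt] qr(4) \<sigma>(2) by simp
      then show ?thesis
        using False qt qr map_comp[OF qr(1) r st(2) qr(3) rt qr(4)] by (simp add: \<phi>_def I_def)
    qed
  qed
  moreover have "\<phi> b (pm_map M b b x) = 1"
    using bs \<sigma>(2)[OF x(1)] \<tau>(2) map_id[OF b(1) x(1)] by (simp add: \<phi>_def)
  ultimately show ?thesis
    unfolding has_interval_summand_def using bI by blast
qed

text \<open>
  The dual situation, with interval \<open>{q. s \<le> q \<or> t \<le> q}\<close>: the vectors at \<open>s\<close> and \<open>t\<close> agree at the
  maximum \<open>e\<close>, and all of \<open>M\<close> outside the interval lands in a subspace \<open>U\<close> that a functional can
  annihilate without vanishing on their common image.
\<close>

lemma summand_above:
  assumes e: "e \<in> P" "\<And>q. q \<in> P \<Longrightarrow> le q e"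
    and st: "s \<in> P" "t \<in> P" "\<And>q. q \<in> P \<Longrightarrow> le s q \<Longrightarrow> le t q \<Longrightarrow> q = e"
    and x: "x \<in> pm_space M s" "x' \<in> pm_space M t" "pm_map M s e x = pm_map M t e x'"
    and U: "subspace U" "pm_map M s e x \<notin> U"
      "\<And>q v. q \<in> P \<Longrightarrow> le s q \<or> le t q \<or> (v \<in> pm_space M q \<longrightarrow> pm_map M q e v \<in> U)"
  shows "has_interval_summand P le M"
proof -
  define I where "I = {q \<in> P. le s q \<or> le t q}"
  have se: "le s e" "le t e"
    using e(2) st(1,2) by blast+
  from functional_separating[OF U(1,2)]
  obtain \<psi> where \<psi>: "linear_between (pm_scale M) UNIV (*) UNIV \<psi>" "\<And>u. u \<in> U \<Longrightarrow> \<psi> u = 0"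
    "\<psi> (pm_map M s e x) = 1"
    by blast
  have eI: "e \<in> I"
    using e se by (simp add: I_def)
  define y where "y q = (if le s q then pm_map M s q x else pm_map M t q x')" for q
  have "is_interval_of P le I"
  proof (rule is_interval_of_centre[OF _ eI])
    show "I \<subseteq> P" "\<And>q. q \<in> I \<Longrightarrow> le e q \<or> le q e"
      using e(2) by (auto simp: I_def)
    fix p q z assume p: "p \<in> I" and "q \<in> I" and z: "z \<in> P" "le p z"
    then have "p \<in> P"
      by (simp add: I_def)
    then show "z \<in> I"
      using le_trans[OF st(1) _ z(1) _ z(2)] le_trans[OF st(2) _ z(1) _ z(2)] z(1) p by (auto simp: I_def)
  qed
  moreover have "interval_section P le M I y"
    unfolding interval_section_def
  proof (intro conjI ballI impI)
    show "y q \<in> pm_space M q" if "q \<in> I" for q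
      using that map_in[OF st(1) _ _ x(1)] map_in[OF st(2) _ _ x(2)] by (auto simp: I_def y_def)
    fix q r assume qr: "q \<in> I" "r \<in> P" "le q r"
    then have q: "q \<in> P"
      by (simp add: I_def)
    show "pm_map M q r (y q) = (if r \<in> I then y r else 0)"
    proof (cases "le s q")
      case True
      have "le s r"
        by (rule le_trans[OF st(1) q qr(2) True qr(3)])
      then show ?thesis
        using True qr map_comp[OF st(1) q qr(2) True qr(3) x(1)] by (simp add: y_def I_def)
    next
      case False
      then have tq: "le t q"
        using qr(1) by (simp add: I_def)
      have tr: "le t r"
        by (rule le_trans[OF st(2) q qr(2) tq qr(3)])
      have "pm_map M s r x = pm_map M t r x'" if "le s r"
        using st(3)[OF qr(2) that tr] x(3) by simp
      then show ?thesis
        using False tr qr map_comp[OF st(2) q qr(2) tq qr(3) x(2)] by (simp add: y_def I_def)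
    qed
  qed
  moreover have "interval_cosection P le M I (\<lambda>q v. \<psi> (pm_map M q e v))"
    unfolding interval_cosection_def
  proof (intro conjI ballI impI)
    show "linear_between (pm_scale M) (pm_space M q) (*) UNIV (\<lambda>v. \<psi> (pm_map M q e v))"
      if "q \<in> I" for q
      using that map_functional_linear[OF _ e(1) e(2) \<psi>(1)] by (simp add: I_def)
    fix q r v assume qr: "q \<in> P" "r \<in> I" "le q r" "v \<in> pm_space M q"
    then have r: "r \<in> P"
      by (simp add: I_def)
    have "\<psi> (pm_map M q e v) = 0" if "q \<notin> I"
      using U(3)[OF qr(1), of v] \<psi>(2) qr that by (auto simp: I_def)
    then show "\<psi> (pm_map M r e (pm_map M q r v)) = (if q \<in> I then \<psi> (pm_map M q e v) else 0)"
      using map_comp[OF qr(1) r e(1) qr(3) e(2)[OF r] qr(4)] by simp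
  qed
  moreover have "\<psi> (pm_map M e e (y e)) = 1"
    using se \<psi>(3) map_id[OF e(1) map_in[OF st(1) e(1) se(1) x(1)]] by (simp add: y_def)
  ultimately show ?thesis
    unfolding has_interval_summand_def using eI by blast
qed

text \<open>
  Along a chain \<open>c 0 < \<dots> < c k\<close> that is closed under passing to smaller and larger elements
  except at its ends, where the module vanishes: take the first non-zero space and follow a vector
  of it as far as it survives.
\<close>

lemma summand_on_chain:
  fixes c :: "nat \<Rightarrow> _"
  assumes c: "\<And>i. i \<le> k \<Longrightarrow> c i \<in> P" "\<And>i j. i \<le> j \<Longrightarrow> j \<le> k \<Longrightarrow> le (c i) (c j)"
    and below: "\<And>i q. 0 < i \<Longrightarrow> i < k \<Longrightarrow> q \<in> P \<Longrightarrow> le q (c i) \<Longrightarrow> \<exists>j\<le>i. q = c j"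
    and above: "\<And>i q. 0 < i \<Longrightarrow> i < k \<Longrightarrow> q \<in> P \<Longrightarrow> le (c i) q \<Longrightarrow> \<exists>j. i \<le> j \<and> j \<le> k \<and> q = c j"
    and ends: "pm_space M (c 0) = {0}" "pm_space M (c k) = {0}"
    and nz: "l \<le> k" "pm_space M (c l) \<noteq> {0}"
  shows "has_interval_summand P le M"
proof -
  obtain i where i: "pm_space M (c i) \<noteq> {0}" "i \<le> k"
    and least: "\<And>j. j < i \<Longrightarrow> pm_space M (c j) = {0}"
    using ex_least_nat_le[of "\<lambda>i. pm_space M (c i) \<noteq> {0}" l] nz by (meson order_trans)
  have i': "0 < i" "i < k"
    using i ends by (auto intro!: Nat.gr0I simp: le_less)
  note ci = c(1)[OF i(2)]
  obtain x where x: "x \<in> pm_space M (c i)" "x \<noteq> 0"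
    using i(1) subspace_0[OF subspace_space[OF ci]] by blast
  define S where "S = {j. i \<le> j \<and> j \<le> k \<and> pm_map M (c i) (c j) x \<noteq> 0}"
  have S: "finite S" "i \<in> S"
    using x i map_id[OF ci x(1)] by (auto simp: S_def)
  define h where "h = Max S"
  have h: "h \<in> S" "\<And>j. j \<in> S \<Longrightarrow> j \<le> h"
    unfolding h_def using Max_in[OF S(1)] Max_ge[OF S(1)] S(2) by blast+
  then have h': "i \<le> h" "h \<le> k" "pm_map M (c i) (c h) x \<noteq> 0"
    by (auto simp: S_def)
  have "h \<noteq> k"
    using map_in[OF ci c(1) c(2) x(1), of k] h' i(2) ends(2) by auto
  then have hk: "h < k" "0 < h"
    using h' i' by auto
  show ?thesis
  proof (rule summand_between[OF ci c(1)[OF h'(2)] c(2)[OF h'(1,2)] x(1) h'(3)])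
    fix q assume q: "q \<in> P" "le (c i) q"
    then obtain j where j: "i \<le> j" "j \<le> k" "q = c j"
      using above[OF i'] by blast
    show "le q (c h) \<or> pm_map M (c i) q x = 0"
    proof (cases "j \<le> h")
      case True
      then show ?thesis
        using c(2)[OF True h'(2)] j by simp
    next
      case False
      then show ?thesis
        using h(2)[of j] j by (auto simp: S_def)
    qed
  next
    fix q assume q: "q \<in> P" "le q (c h)"
    then obtain j where j: "j \<le> h" "q = c j"
      using below[OF hk(2,1)] by blast
    show "le (c i) q \<or> pm_space M q = {0}"
      using c(2)[of i j] least[of j] j h'(2) by (cases "i \<le> j") auto
  qed
qed

end

section \<open>Bipath modules\<close>

text \<open>The second chain, listed upwards: \<open>0, n + m - 1, \<dots>, n + 1, n\<close>.\<close>

definition right_chain :: "nat \<Rightarrow> nat \<Rightarrow> nat \<Rightarrow> nat" where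
  "right_chain n m j = (if j = 0 then 0 else n + m - j)"

lemma right_chain_carrier: "0 < n \<Longrightarrow> j \<le> m \<Longrightarrow> right_chain n m j \<in> bipath_carrier n m"
  by (auto simp: right_chain_def bipath_carrier_def)

lemma right_chain_le:
  "0 < n \<Longrightarrow> 0 < m \<Longrightarrow> i \<le> j \<Longrightarrow> j \<le> m \<Longrightarrow> bipath_le n m (right_chain n m i) (right_chain n m j)"
  by (auto simp: right_chain_def bipath_le_def)

lemma right_chain_of:
  assumes "q \<in> bipath_carrier n m" "n \<le> q" "0 < n"
  shows "q = right_chain n m (n + m - q)" "n + m - q \<le> m"
  using assms by (auto simp: right_chain_def bipath_carrier_def)

lemma right_chain_below:
  assumes "0 < i" "i < m" "q \<in> bipath_carrier n m" "bipath_le n m q (right_chain n m i)"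
  shows "\<exists>j\<le>i. q = right_chain n m j"
proof (cases "q = 0")
  case True
  then show ?thesis
    by (intro exI[of _ 0]) (simp add: right_chain_def)
next
  case False
  then show ?thesis
    using assms by (intro exI[of _ "n + m - q"]) (auto simp: right_chain_def bipath_le_def bipath_carrier_def)
qed

lemma right_chain_above:
  assumes "0 < i" "i < m" "0 < n" "q \<in> bipath_carrier n m" "bipath_le n m (right_chain n m i) q"
  shows "\<exists>j. i \<le> j \<and> j \<le> m \<and> q = right_chain n m j"
  using assms by (intro exI[of _ "n + m - q"]) (auto simp: right_chain_def bipath_le_def bipath_carrier_def)

text \<open>
  If the map from \<open>0\<close> to \<open>n\<close> vanishes, then in the space at \<open>0\<close> the kernels of the maps to the points
  of either chain grow from zero to the whole space.  Let \<open>s\<close> be the first place of the first chain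
  where the kernel is non-zero, and \<open>t\<close> the first place of the second chain where the kernel meets
  that one non-trivially.  A non-zero vector in this intersection lives exactly on the points before
  \<open>s\<close> and before \<open>t\<close>, and the map to the point before \<open>s\<close> is injective.  The images in the space
  at \<open>n\<close> behave in the same way: going back along the chains they shrink to zero.
\<close>

lemma bipath_summand:
  fixes M :: "(nat, 'k::field, 'v::ab_group_add) pmod"
  assumes nm: "n > 1" "m > 1" and M: "persistence_module (bipath_carrier n m) (bipath_le n m) M"
    and nz: "\<exists>p\<in>bipath_carrier n m. pm_space M p \<noteq> {0}"
  shows "has_interval_summand (bipath_carrier n m) (bipath_le n m) M"
proof -
  let ?P = "bipath_carrier n m" and ?le = "bipath_le n m" and ?r = "right_chain n m"
  interpret ordered_pers_module ?P ?le M
    by unfold_locales (use M nm in \<open>auto simp: bipath_carrier_def bipath_le_def\<close>)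
  have P0: "0 \<in> ?P" and Pn: "n \<in> ?P" and Pl: "\<And>i. i \<le> n \<Longrightarrow> i \<in> ?P"
    using nm by (auto simp: bipath_carrier_def)
  have le0: "?le 0 q" and len: "?le q n" if "q \<in> ?P" for q
    using that nm by (auto simp: bipath_carrier_def bipath_le_def)
  have lel: "?le i j" if "i \<le> j" "j \<le> n" for i j
    using that by (simp add: bipath_le_def)
  have r: "?r 0 = 0" "?r m = n"
    using nm by (auto simp: right_chain_def)
  have Pr: "?r j \<in> ?P" if "j \<le> m" for j
    using right_chain_carrier[of n j m] that nm by simp
  have ler: "?le (?r i) (?r j)" if "i \<le> j" "j \<le> m" for i j
    using right_chain_le[of n m i j] that nm by simp
  show ?thesis
  proof (cases "\<exists>x\<in>pm_space M 0. pm_map M 0 n x \<noteq> 0")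
    case True
    then show ?thesis
      using summand_between[OF P0 Pn le0[OF Pn]] le0 len by blast
  next
    case False
    then have zero: "pm_map M 0 n v = 0" if "v \<in> pm_space M 0" for v
      using that by blast
    consider (source) "pm_space M 0 \<noteq> {0}" | (sink) "pm_space M n \<noteq> {0}"
      | (inner) "pm_space M 0 = {0}" "pm_space M n = {0}"
      by blast
    then show ?thesis
    proof cases
      case source
      obtain v where v: "v \<in> pm_space M 0" "v \<noteq> 0"
        using source subspace_0[OF subspace_space[OF P0]] by blast
      \<comment> \<open>\<open>K i\<close> says that the map to \<open>i\<close> along the first chain has a non-zero kernel.\<close>
      define K where "K i \<longleftrightarrow> (\<exists>v\<in>pm_space M 0. v \<noteq> 0 \<and> pm_map M 0 i v = 0)" for i
      have "K n"
        using v zero by (auto simp: K_def)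
      then obtain s where s: "K s" "s \<le> n" "\<And>i. i < s \<Longrightarrow> \<not> K i"
        using ex_least_nat_le[of K n] by blast
      have "\<not> K 0"
        using map_id[OF P0] by (auto simp: K_def)
      then have s0: "0 < s"
        using s(1) by (auto intro: Nat.gr0I)
      \<comment> \<open>\<open>L j\<close> says that the kernel at \<open>s\<close> meets the one at place \<open>j\<close> of the second chain non-trivially.\<close>
      define L where "L j \<longleftrightarrow> (\<exists>v\<in>pm_space M 0. v \<noteq> 0 \<and> pm_map M 0 s v = 0 \<and> pm_map M 0 (?r j) v = 0)" for j
      have "L m"
        using s(1) zero r by (auto simp: K_def L_def)
      then obtain t where t: "L t" "t \<le> m" "\<And>j. j < t \<Longrightarrow> \<not> L j"
        using ex_least_nat_le[of L m] by blast
      have "\<not> L 0"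
        using map_id[OF P0] r by (auto simp: L_def)
      then have t0: "0 < t"
        using t(1) by (auto intro: Nat.gr0I)
      obtain x where x: "x \<in> pm_space M 0" "x \<noteq> 0" "pm_map M 0 s x = 0" "pm_map M 0 (?r t) x = 0"
        using t(1) by (auto simp: L_def)
      have ps: "s - 1 \<in> ?P" "s \<in> ?P" and pt: "?r (t - 1) \<in> ?P" "?r t \<in> ?P"
        using s(2) t(2) Pl Pr by auto
      show ?thesis
      proof (rule summand_below[OF P0 le0 ps(1) pt(1)])
        show "q = 0" if "?le q (s - 1)" "?le q (?r (t - 1))" for q
          using that s0 s(2) t0 t(2) nm by (auto simp: bipath_le_def right_chain_def split: if_splits)
        show "v = 0" if "v \<in> pm_space M 0" "pm_map M 0 (s - 1) v = 0" for v
          using that s(3)[of "s - 1"] s0 by (auto simp: K_def)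
        show "x \<in> pm_space M 0"
          by (rule x(1))
        show "pm_map M 0 (?r (t - 1)) x \<noteq> 0"
          using t(3)[of "t - 1"] t0 x by (auto simp: L_def)
        fix q assume q: "q \<in> ?P"
        show "?le q (s - 1) \<or> ?le q (?r (t - 1)) \<or> pm_map M 0 q x = 0"
        proof (cases "q \<le> n")
          case True
          show ?thesis
          proof (cases "q < s")
            case True
            then show ?thesis
              using lel[of q "s - 1"] s(2) by simp
          next
            case False
            then have "?le s q"
              using True by (intro lel) auto
            then show ?thesis
              using map_comp[OF P0 ps(2) q le0[OF ps(2)] _ x(1)] x(3) map_zero[OF ps(2) q] by auto
          qed
        next
          case False
          then obtain j where j: "q = ?r j" "j \<le> m"
            using right_chain_of[OF q] nm by force
          show ?thesis
          proof (cases "j < t")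
            case True
            then show ?thesis
              using ler[of j "t - 1"] j t(2) by simp
          next
            case False
            then have "?le (?r t) q"
              using ler[of t j] j by simp
            then show ?thesis
              using map_comp[OF P0 pt(2) q le0[OF pt(2)] _ x(1)] x(4) map_zero[OF pt(2) q] by auto
          qed
        qed
      qed
    next
      case sink
      obtain v where v: "v \<in> pm_space M n" "v \<noteq> 0"
        using sink subspace_0[OF subspace_space[OF Pn]] by blast
      \<comment> \<open>\<open>K i\<close> says that the image of the map from \<open>i\<close> to the maximum is non-zero.\<close>
      define K where "K i \<longleftrightarrow> (\<exists>v\<in>pm_space M i. pm_map M i n v \<noteq> 0)" for i
      have "K n"
        using v map_id[OF Pn] by (auto simp: K_def)
      then obtain s where s: "K s" "s \<le> n" "\<And>i. i < s \<Longrightarrow> \<not> K i"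
        using ex_least_nat_le[of K n] by blast
      have "\<not> K 0"
        using zero by (auto simp: K_def)
      then have s0: "0 < s"
        using s(1) by (auto intro: Nat.gr0I)
      have ps: "s \<in> ?P"
        using Pl s(2) by simp
      \<comment> \<open>\<open>L j\<close> says that the images from \<open>s\<close> and from place \<open>j\<close> of the second chain meet non-trivially.\<close>
      define L where "L j \<longleftrightarrow> (\<exists>x\<in>pm_space M s. \<exists>x'\<in>pm_space M (?r j).
          pm_map M s n x \<noteq> 0 \<and> pm_map M s n x = pm_map M (?r j) n x')" for j
      have "L m"
        using s(1) r map_in[OF ps Pn len[OF ps]] map_id[OF Pn] by (fastforce simp: K_def L_def)
      then obtain t where t: "L t" "t \<le> m" "\<And>j. j < t \<Longrightarrow> \<not> L j"
        using ex_least_nat_le[of L m] by blast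
      have "\<not> L 0"
        using zero r by (auto simp: L_def)
      then have t0: "0 < t"
        using t(1) by (auto intro: Nat.gr0I)
      obtain x x' where x: "x \<in> pm_space M s" "x' \<in> pm_space M (?r t)" "pm_map M s n x \<noteq> 0"
          "pm_map M s n x = pm_map M (?r t) n x'"
        using t(1) by (auto simp: L_def)
      have pt: "?r (t - 1) \<in> ?P" "?r t \<in> ?P"
        using t(2) Pr by auto
      let ?U = "pm_map M (?r (t - 1)) n ` pm_space M (?r (t - 1))"
      have U: "subspace ?U"
        by (rule subspace_linear_between_image[OF map_linear[OF pt(1) Pn len[OF pt(1)]]
              vector_space_axioms subspace_space[OF pt(1)]])
      show ?thesis
      proof (rule summand_above[OF Pn len ps pt(2) _ x(1,2,4) U])
        show "q = n" if "?le s q" "?le (?r t) q" for q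
          using that s0 s(2) t0 t(2) nm by (auto simp: bipath_le_def right_chain_def split: if_splits)
        show "pm_map M s n x \<notin> ?U"
          using t(3)[of "t - 1"] t0 x by (auto simp: L_def)
        fix q v assume q: "q \<in> ?P"
        show "?le s q \<or> ?le (?r t) q \<or> (v \<in> pm_space M q \<longrightarrow> pm_map M q n v \<in> ?U)"
        proof (cases "q \<le> n")
          case True
          show ?thesis
          proof (cases "q < s")
            case True
            then show ?thesis
              using s(3)[of q] subspace_0[OF U] by (auto simp: K_def)
          next
            case False
            then show ?thesis
              using lel[of s q] \<open>q \<le> n\<close> by simp
          qed
        next
          case False
          then obtain j where j: "q = ?r j" "j \<le> m"
            using right_chain_of[OF q] nm by force
          show ?thesis
          proof (cases "j < t")
            case True
            then have "?le q (?r (t - 1))"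
              using ler[of j "t - 1"] j t(2) by simp
            then show ?thesis
              using map_comp[OF q pt(1) Pn _ len[OF pt(1)], of v] map_in[OF q pt(1), of v]
              by (metis imageI)
          next
            case False
            then show ?thesis
              using ler[of t j] j by simp
          qed
        qed
      qed
    next
      case inner
      obtain p where p: "p \<in> ?P" "pm_space M p \<noteq> {0}"
        using nz by blast
      show ?thesis
      proof (cases "p \<le> n")
        case True
        show ?thesis
        proof (rule summand_on_chain[of n "\<lambda>i. i" p])
          show "\<exists>j\<le>i. q = j" if "0 < i" "i < n" "?le q i" for i q
            using that by (auto simp: bipath_le_def)
          show "\<exists>j. i \<le> j \<and> j \<le> n \<and> q = j" if "0 < i" "i < n" "?le i q" for i q
            using that by (auto simp: bipath_le_def)
        qed (fact Pl lel inner True p(2))+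
      next
        case False
        then have *: "p = ?r (n + m - p)" "n + m - p \<le> m"
          using right_chain_of[OF p(1)] nm by auto
        show ?thesis
        proof (rule summand_on_chain[of m ?r, OF Pr ler _ _ _ _ *(2)])
          show "\<exists>j\<le>i. q = ?r j" if "0 < i" "i < m" "q \<in> ?P" "?le q (?r i)" for i q
            using right_chain_below[OF that] .
          show "\<exists>j. i \<le> j \<and> j \<le> m \<and> q = ?r j" if "0 < i" "i < m" "q \<in> ?P" "?le (?r i) q" for i q
            using right_chain_above[OF that(1,2) _ that(3,4)] nm by simp
        qed (use inner r p(2) *(1) in auto)
      qed
    qed
  qed
qed

lemma bipath_interval_basis:
  fixes M :: "(nat, 'k::field, 'v::ab_group_add) pmod"
  assumes "n > 1" "m > 1" "bipath_module n m M"
  shows "\<exists>(k::nat) J x \<phi>. interval_basis (bipath_carrier n m) (bipath_le n m) M {..<k} J x \<phi>"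
proof (rule interval_basis_exists)
  show "persistence_module (bipath_carrier n m) (bipath_le n m) M"
    using assms(3) unfolding bipath_module_def .
qed (use bipath_summand[OF assms(1,2)] in \<open>auto simp: bipath_carrier_def\<close>)

section \<open>Pulling back along an order-preserving map\<close>

definition pullback :: "('q \<Rightarrow> 'p) \<Rightarrow> ('p, 'k, 'v) pmod \<Rightarrow> ('q, 'k, 'v) pmod" where
  "pullback f M = \<lparr>pm_scale = pm_scale M, pm_space = (\<lambda>x. pm_space M (f x)),
     pm_map = (\<lambda>x y. pm_map M (f x) (f y))\<rparr>"

lemma pullback_simps [simp]:
  "pm_scale (pullback f M) = pm_scale M"
  "pm_space (pullback f M) x = pm_space M (f x)"
  "pm_map (pullback f M) x y = pm_map M (f x) (f y)"
  unfolding pullback_def by simp_all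

definition conn :: "('q \<Rightarrow> 'q \<Rightarrow> bool) \<Rightarrow> 'q set \<Rightarrow> ('q \<times> 'q) set" where
  "conn le U = {(x, y). x \<in> U \<and> y \<in> U \<and> (le x y \<or> le y x)}\<^sup>*"

definition components :: "('q \<Rightarrow> 'q \<Rightarrow> bool) \<Rightarrow> 'q set \<Rightarrow> 'q set set" where
  "components le U = (\<lambda>x. conn le U `` {x}) ` U"

lemma conn_refl: "(x, x) \<in> conn le U"
  unfolding conn_def by blast

lemma conn_trans: "(x, y) \<in> conn le U \<Longrightarrow> (y, z) \<in> conn le U \<Longrightarrow> (x, z) \<in> conn le U"
  unfolding conn_def by (rule rtrancl_trans)

lemma conn_step: "x \<in> U \<Longrightarrow> y \<in> U \<Longrightarrow> le x y \<or> le y x \<Longrightarrow> (x, y) \<in> conn le U"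
  unfolding conn_def by blast

lemma conn_sym: "(x, y) \<in> conn le U \<Longrightarrow> (y, x) \<in> conn le U"
  unfolding conn_def by (rule symD[OF sym_rtrancl]) (auto simp: sym_def)

lemma conn_in: "(x, y) \<in> conn le U \<Longrightarrow> x \<in> U \<Longrightarrow> y \<in> U"
  unfolding conn_def by (induction rule: rtrancl_induct) auto

text \<open>A path stays in the component of its starting point.\<close>

lemma conn_component:
  assumes "(x, y) \<in> conn le U"
  shows "(x, y) \<in> conn le (conn le U `` {x})"
  using assms
  unfolding conn_def[of le U]
proof (induction rule: rtrancl_induct)
  case base
  show ?case
    by (rule conn_refl)
next
  case (step y z)
  then have "(x, y) \<in> conn le U" "(y, z) \<in> conn le U"
    unfolding conn_def by auto
  then have "y \<in> conn le U `` {x}" "z \<in> conn le U `` {x}"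
    using conn_trans by fast+
  then have "(y, z) \<in> conn le (conn le U `` {x})"
    using step by (intro conn_step) auto
  then show ?case
    using step conn_trans unfolding conn_def[of le U] by fast
qed

lemma component_eq: "(x, y) \<in> conn le U \<Longrightarrow> conn le U `` {x} = conn le U `` {y}"
  using conn_sym conn_trans by fast

lemma components_eq_conn:
  assumes "C \<in> components le U" "x \<in> C"
  shows "x \<in> U" "C = conn le U `` {x}"
  using assms component_eq conn_in unfolding components_def by fast+

text \<open>
  Convexity: a point between two points of the component lies over \<open>I\<close>, as \<open>I\<close> is convex, and is
  comparable to them.
\<close>

lemma component_is_interval:
  assumes f: "\<And>x y. x \<in> Q \<Longrightarrow> y \<in> Q \<Longrightarrow> leQ x y \<Longrightarrow> le (f x) (f y)" "\<And>x. x \<in> Q \<Longrightarrow> f x \<in> P"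
    and I: "is_interval_of P le I" and C: "C \<in> components leQ {x \<in> Q. f x \<in> I}"
  shows "is_interval_of Q leQ C"
proof -
  let ?U = "{x \<in> Q. f x \<in> I}"
  obtain x where x: "x \<in> ?U" "C = conn leQ ?U `` {x}"
    using C unfolding components_def by blast
  have CU: "C \<subseteq> ?U"
    using components_eq_conn(1)[OF C] by blast
  show ?thesis
    unfolding is_interval_of_def
  proof (intro conjI ballI impI)
    show "C \<subseteq> Q"
      using CU by blast
    show "C \<noteq> {}"
      using x(2) conn_refl by fast
    fix p q assume p: "p \<in> C" and q: "q \<in> C"
    have "(p, q) \<in> conn leQ C"
      using conn_component[of p q leQ ?U] components_eq_conn(2)[OF C p] q by simp
    then show "(p, q) \<in> {(x, y). x \<in> C \<and> y \<in> C \<and> (leQ x y \<or> leQ y x)}\<^sup>*"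
      unfolding conn_def .
    fix z assume z: "z \<in> Q" "leQ p z" "leQ z q"
    have "f z \<in> I"
      by (rule is_interval_ofD(3)[OF I, of "f p" "f q"]) (use p q z CU f in blast)+
    then have "(p, z) \<in> conn leQ ?U"
      using p CU z by (intro conn_step) auto
    then show "z \<in> C"
      using components_eq_conn(2)[OF C p] by simp
  qed
qed

context pers_module
begin

lemma persistence_module_pullback:
  assumes f: "\<And>x y. x \<in> Q \<Longrightarrow> y \<in> Q \<Longrightarrow> leQ x y \<Longrightarrow> le (f x) (f y)" "\<And>x. x \<in> Q \<Longrightarrow> f x \<in> P"
  shows "persistence_module Q leQ (pullback f M)"
  unfolding persistence_module_def pullback_simps
  using f vector_space_axioms finite_span map_linear map_id map_comp by auto

text \<open>
  The basis vectors of the pull-back are those of \<open>M\<close>, cut up along the components of the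
  preimages: a vector dies when its path leaves the preimage of its interval, and a component can
  only be left in that way.
\<close>

lemma interval_basis_pullback:
  assumes f: "\<And>x y. x \<in> Q \<Longrightarrow> y \<in> Q \<Longrightarrow> leQ x y \<Longrightarrow> le (f x) (f y)" "\<And>x. x \<in> Q \<Longrightarrow> f x \<in> P"
    and B: "interval_basis P le M A J x \<phi>"
  shows "interval_basis Q leQ (pullback f M)
    {(a, C). a \<in> A \<and> C \<in> components leQ {q \<in> Q. f q \<in> J a}} snd
    (\<lambda>a q. x (fst a) (f q)) (\<lambda>a q. \<phi> (fst a) (f q))"
proof -
  let ?U = "\<lambda>a. {q \<in> Q. f q \<in> J a}"
  let ?A = "{(a, C). a \<in> A \<and> C \<in> components leQ (?U a)}"
  have in_U: "q \<in> Q \<and> f q \<in> J (fst a)" if "a \<in> ?A" "q \<in> snd a" for a q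
    using that components_eq_conn(1)[of "snd a" leQ "?U (fst a)" q] by auto
  have bij: "bij_betw fst {a \<in> ?A. q \<in> snd a} {a \<in> A. f q \<in> J a}" if q: "q \<in> Q" for q
    unfolding bij_betw_def
  proof
    show "inj_on fst {a \<in> ?A. q \<in> snd a}"
    proof (rule inj_onI)
      fix a b assume a: "a \<in> {a \<in> ?A. q \<in> snd a}" and b: "b \<in> {a \<in> ?A. q \<in> snd a}" and eq: "fst a = fst b"
      have "snd a = conn leQ (?U (fst a)) `` {q}" "snd b = conn leQ (?U (fst b)) `` {q}"
        by (rule components_eq_conn(2); use a b in auto)+
      then show "a = b"
        using eq by (simp add: prod_eq_iff)
    qed
    show "fst ` {a \<in> ?A. q \<in> snd a} = {a \<in> A. f q \<in> J a}"
    proof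
      show "fst ` {a \<in> ?A. q \<in> snd a} \<subseteq> {a \<in> A. f q \<in> J a}"
      proof
        fix a assume "a \<in> fst ` {a \<in> ?A. q \<in> snd a}"
        then obtain b where b: "a = fst b" "b \<in> ?A" "q \<in> snd b"
          by blast
        have "fst b \<in> A"
          using b(2) by auto
        then show "a \<in> {a \<in> A. f q \<in> J a}"
          using in_U[OF b(2,3)] b(1) by simp
      qed
      show "{a \<in> A. f q \<in> J a} \<subseteq> fst ` {a \<in> ?A. q \<in> snd a}"
      proof
        fix a assume a: "a \<in> {a \<in> A. f q \<in> J a}"
        have "(a, conn leQ (?U a) `` {q}) \<in> {a \<in> ?A. q \<in> snd a}"
          using a q by (simp add: components_def conn_refl)
        then show "a \<in> fst ` {a \<in> ?A. q \<in> snd a}"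
          by (rule rev_image_eqI) simp
      qed
    qed
  qed
  show ?thesis
    unfolding interval_basis_def pullback_simps
  proof (intro conjI ballI allI impI)
    fix a assume a: "a \<in> ?A"
    then have a': "fst a \<in> A" "snd a \<in> components leQ (?U (fst a))"
      by auto
    show "is_interval_of Q leQ (snd a)"
      using component_is_interval[OF f interval_basisD(1)[OF B a'(1)] a'(2)] .
    note sec = interval_basisD(3)[OF B a'(1)]
    show "interval_section Q leQ (pullback f M) (snd a) (\<lambda>q. x (fst a) (f q))"
      unfolding interval_section_def pullback_simps
    proof (intro conjI ballI impI)
      fix p assume p: "p \<in> snd a"
      show "x (fst a) (f p) \<in> pm_space M (f p)"
        using interval_sectionD(1)[OF sec] in_U[OF a p] by blast
      fix q assume q: "q \<in> Q" "leQ p q"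
      have "q \<in> snd a \<longleftrightarrow> f q \<in> J (fst a)"
      proof
        assume "f q \<in> J (fst a)"
        then have "(p, q) \<in> conn leQ (?U (fst a))"
          using in_U[OF a p] q by (intro conn_step) auto
        then show "q \<in> snd a"
          using components_eq_conn(2)[OF a'(2) p] by blast
      qed (use in_U[OF a, of q] in simp)
      then show "pm_map M (f p) (f q) (x (fst a) (f p)) = (if q \<in> snd a then x (fst a) (f q) else 0)"
        using interval_sectionD(2)[OF sec, of "f p" "f q"] in_U[OF a p] q f by simp
    qed
    show "linear_between (pm_scale M) (pm_space M (f p)) (*) UNIV (\<phi> (fst a) (f p))" if "p \<in> snd a" for p
      using interval_basisD(4)[OF B a'(1)] in_U[OF a that] by blast
    fix b p assume b: "b \<in> ?A" and p: "p \<in> snd a" "p \<in> snd b"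
    have b': "fst b \<in> A"
      using b by auto
    have "fst a = fst b \<longleftrightarrow> a = b"
      using inj_on_eq_iff[OF bij_betw_imp_inj_on[OF bij], of p a b] in_U[OF a p(1)] a b p by simp
    then show "\<phi> (fst a) (f p) (x (fst b) (f p)) = (if a = b then 1 else 0)"
      using interval_basisD(5)[OF B a'(1) b', of "f p"] in_U[OF a p(1)] in_U[OF b p(2)] by simp
  next
    fix q assume q: "q \<in> Q"
    show "finite {a \<in> ?A. q \<in> snd a}"
      using bij_betw_finite[OF bij[OF q]] interval_basisD(2)[OF B f(2)[OF q]] by blast
    show "v = (\<Sum>a\<in>{a \<in> ?A. q \<in> snd a}. pm_scale M (\<phi> (fst a) (f q) v) (x (fst a) (f q)))"
      if "v \<in> pm_space M (f q)" for v
      using sum.reindex_bij_betw[OF bij[OF q], of "\<lambda>a. pm_scale M (\<phi> a (f q) v) (x a (f q))"]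
        interval_basisD(6)[OF B f(2)[OF q] that] by simp
  qed
qed

end

lemma pm_iso_pullback:
  assumes f: "\<And>x y. x \<in> Q \<Longrightarrow> y \<in> Q \<Longrightarrow> leQ x y \<Longrightarrow> le (f x) (f y)" "\<And>x. x \<in> Q \<Longrightarrow> f x \<in> P"
    and iso: "pm_iso P le M N"
  shows "pm_iso Q leQ (pullback f M) (pullback f N)"
proof -
  from iso obtain h g where hg: "pm_hom P le M N h" "pm_hom P le N M g"
    "\<forall>p\<in>P. (\<forall>x\<in>pm_space M p. g p (h p x) = x) \<and> (\<forall>y\<in>pm_space N p. h p (g p y) = y)"
    unfolding pm_iso_def by blast
  have "pm_hom Q leQ (pullback f M) (pullback f N) (\<lambda>q. h (f q))"
    "pm_hom Q leQ (pullback f N) (pullback f M) (\<lambda>q. g (f q))"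
    using hg(1,2) f unfolding pm_hom_def by simp_all
  then show ?thesis
    unfolding pm_iso_def using hg(3) f(2)
    by (intro exI[of _ "\<lambda>q. h (f q)"] exI[of _ "\<lambda>q. g (f q)"]) simp
qed

section \<open>The covering map\<close>

text \<open>The zigzag poset, listed from left to right; the elements at odd positions are minimal.\<close>

definition zz_pos :: "int \<Rightarrow> int \<times> int" where
  "zz_pos t = ((t + 1) div 2, t div 2)"

lemma zz_pos_carrier: "zz_pos t \<in> zz_carrier"
  unfolding zz_pos_def zz_carrier_def by simp presburger

lemma zz_carrier_pos:
  assumes "x \<in> zz_carrier"
  obtains t where "x = zz_pos t"
proof -
  have "x = zz_pos (fst x + snd x)"
    using assms unfolding zz_pos_def zz_carrier_def by auto
  then show thesis
    by (rule that)
qed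

lemma zz_le_pos:
  assumes "zz_le (zz_pos s) (zz_pos t)"
  shows "s = t \<or> odd s \<and> (t = s + 1 \<or> s = t + 1)"
proof -
  have "(t + 1) div 2 \<le> (s + 1) div 2" "s div 2 \<le> t div 2"
    using assms by (simp_all add: zz_le_def zz_pos_def)
  then show ?thesis
    by (cases "even s"; cases "even t") (auto elim!: evenE oddE)
qed

lemma zz_pos_adjacent: "zz_le (zz_pos t) (zz_pos (t + 1)) \<or> zz_le (zz_pos (t + 1)) (zz_pos t)"
  by (cases "even t") (auto elim!: evenE oddE simp: zz_le_def zz_pos_def)

lemma conn_zz_segment:
  assumes "s \<le> t" "\<And>u. s \<le> u \<Longrightarrow> u \<le> t \<Longrightarrow> zz_pos u \<in> U"
  shows "(zz_pos s, zz_pos t) \<in> conn zz_le U"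
  using assms
proof (induction t rule: int_ge_induct)
  case base
  show ?case
    by (rule conn_refl)
next
  case (step t)
  have "(zz_pos t, zz_pos (t + 1)) \<in> conn zz_le U"
    by (rule conn_step) (use step.hyps step.prems zz_pos_adjacent in auto)
  then show ?case
    using step by (intro conn_trans[OF step.IH]) auto
qed

lemma conn_zz_between:
  assumes "\<And>u. min s t \<le> u \<Longrightarrow> u \<le> max s t \<Longrightarrow> zz_pos u \<in> U"
  shows "(zz_pos s, zz_pos t) \<in> conn zz_le U"
proof (cases "s \<le> t")
  case True
  then show ?thesis
    using assms by (intro conn_zz_segment) auto
next
  case False
  then show ?thesis
    using assms by (intro conn_sym[OF conn_zz_segment]) auto
qed

locale bipath_covering =
  fixes n m :: nat
  assumes nm: "n > 1" "m > 1"
begin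

definition period :: int where
  "period = int (n + m - 1)"

lemma period: "period = int n + int m - 1" "int n < period"
  using nm by (auto simp: period_def)

abbreviation "cov t \<equiv> covering n m (zz_pos t)"

text \<open>
  With \<open>N = period\<close>, one period of the zigzag is covered by two windows of positions, \<open>1..2n\<close>
  running up the first chain and \<open>2n..2N + 1\<close> running down the second one.
\<close>

lemma covering_mod:
  assumes "b mod period = r"
  shows "covering n m (a, b)
    = (if a = b then (if r = 0 then n + m - 1 else nat r) else if r < int n then nat r else nat r + 1)"
proof -
  have "0 \<le> r"
    using assms period by auto
  then show ?thesis
    unfolding covering_def Let_def period_def[symmetric] prod.case assms by auto
qed

lemma zz_pos_even: "zz_pos (2 * t) = (t, t)" and zz_pos_odd: "zz_pos (2 * t + 1) = (t + 1, t)"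
  by (simp_all add: zz_pos_def)

lemma cov_even: "cov (2 * k * period + 2 * v) = covering n m (k * period + v, k * period + v)"
  using zz_pos_even[of "k * period + v"] by (simp add: algebra_simps)

lemma cov_odd: "cov (2 * k * period + (2 * v + 1)) = covering n m (k * period + v + 1, k * period + v)"
  using zz_pos_odd[of "k * period + v"] by (simp add: algebra_simps)

lemma cov_left:
  assumes "1 \<le> w" "w \<le> 2 * int n"
  shows "cov (2 * k * period + w) = nat (w div 2)"
proof (cases "even w")
  case True
  then obtain v where v: "w = 2 * v"
    by (rule evenE)
  have "(k * period + v) mod period = v"
    using assms v period by simp
  then show ?thesis
    unfolding v cov_even using covering_mod assms v by simp
next
  case False
  then obtain v where v: "w = 2 * v + 1"
    by (rule oddE)
  have "(k * period + v) mod period = v"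
    using assms v period by simp
  then show ?thesis
    unfolding v cov_odd using covering_mod assms v by simp
qed

lemma cov_right:
  assumes "2 * int n \<le> w" "w \<le> 2 * period + 1"
  shows "cov (2 * k * period + w) = right_chain n m (nat (period + 1 - (w + 1) div 2))"
proof -
  have md: "(k * period + v) mod period = (if v = period then 0 else v)" if "0 \<le> v" "v \<le> period" for v
    using that by simp
  show ?thesis
  proof (cases "even w")
    case True
    then obtain v where v: "w = 2 * v"
      by (rule evenE)
    have "cov (2 * k * period + w) = nat v"
      unfolding v cov_even using covering_mod[OF md, of v] assms v nm period by auto
    then show ?thesis
      using assms v period by (auto simp: right_chain_def)
  next
    case False
    then obtain v where v: "w = 2 * v + 1"
      by (rule oddE)
    have "cov (2 * k * period + w) = (if v = period then 0 else nat v + 1)"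
      unfolding v cov_odd using covering_mod[OF md, of v] assms v nm period by auto
    then show ?thesis
      using assms v period by (auto simp: right_chain_def)
  qed
qed

lemma position_cases:
  obtains k w where "t = 2 * k * period + w" "l \<le> w" "w < l + 2 * period"
proof -
  have "t = 2 * ((t - l) div (2 * period)) * period + (l + (t - l) mod (2 * period))"
    using div_mult_mod_eq[of "t - l" "2 * period"] by (simp add: algebra_simps)
  moreover have "0 \<le> (t - l) mod (2 * period)" "(t - l) mod (2 * period) < 2 * period"
    using period by simp_all
  ultimately show thesis
    by (intro that) auto
qed

lemma cov_adjacent:
  shows "odd t \<Longrightarrow> bipath_le n m (cov t) (cov (t + 1))"
    and "even t \<Longrightarrow> bipath_le n m (cov (t + 1)) (cov t)"
proof -
  obtain k w where w: "t = 2 * k * period + w" "1 \<le> w" "w < 1 + 2 * period"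
    by (rule position_cases)
  have t1: "t + 1 = 2 * k * period + (w + 1)"
    using w by simp
  have par: "even t \<longleftrightarrow> even w"
    using w by simp
  have "(odd t \<longrightarrow> bipath_le n m (cov t) (cov (t + 1))) \<and> (even t \<longrightarrow> bipath_le n m (cov (t + 1)) (cov t))"
  proof (cases "w + 1 \<le> 2 * int n")
    case True
    have *: "w div 2 \<le> (w + 1) div 2" "(w + 1) div 2 \<le> int n" "even w \<Longrightarrow> (w + 1) div 2 = w div 2" "0 \<le> w div 2"
      using True w by presburger+
    have "cov t = nat (w div 2)" "cov (t + 1) = nat ((w + 1) div 2)"
      unfolding t1 unfolding w(1) using True w(2) by (intro cov_left; simp)+
    then show ?thesis
      unfolding par using * by (auto simp: bipath_le_def nat_mono)
  next
    case False
    have *: "(w + 2) div 2 \<le> period + 1" "int n \<le> (w + 1) div 2" "(w + 1) div 2 \<le> (w + 2) div 2"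
       "odd w \<Longrightarrow> (w + 2) div 2 = (w + 1) div 2"
      using False w by presburger+
    have "bipath_le n m (right_chain n m (nat (period + 1 - (w + 2) div 2)))
       (right_chain n m (nat (period + 1 - (w + 1) div 2)))"
      by (rule right_chain_le) (use * nm period in auto)
    moreover have "cov t = right_chain n m (nat (period + 1 - (w + 1) div 2))"
      "cov (t + 1) = right_chain n m (nat (period + 1 - (w + 2) div 2))"
      unfolding t1 unfolding w(1) using cov_right[of w k] cov_right[of "w + 1" k] False w by auto
    ultimately show ?thesis
      unfolding par using *(4) by auto
  qed
  then show "odd t \<Longrightarrow> bipath_le n m (cov t) (cov (t + 1))"
    "even t \<Longrightarrow> bipath_le n m (cov (t + 1)) (cov t)"
    by auto
qed

lemma covering_carrier: "x \<in> zz_carrier \<Longrightarrow> covering n m x \<in> bipath_carrier n m"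
proof (erule zz_carrier_pos)
  fix t assume x: "x = zz_pos t"
  obtain k w where w: "t = 2 * k * period + w" "1 \<le> w" "w < 1 + 2 * period"
    by (rule position_cases)
  show "covering n m x \<in> bipath_carrier n m"
  proof (cases "w \<le> 2 * int n")
    case True
    then show ?thesis
      unfolding x w(1) using w(2) nm by (simp add: cov_left bipath_carrier_def)
  next
    case False
    then show ?thesis
      unfolding x w(1) using w(2,3) nm period
      by (subst cov_right) (auto intro!: right_chain_carrier)
  qed
qed

lemma covering_mono:
  assumes "x \<in> zz_carrier" "y \<in> zz_carrier" "zz_le x y"
  shows "bipath_le n m (covering n m x) (covering n m y)"
proof -
  obtain s t where st: "x = zz_pos s" "y = zz_pos t"
    using assms(1,2) zz_carrier_pos by metis
  have "s = t \<or> odd s \<and> (t = s + 1 \<or> s = t + 1)"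
    using zz_le_pos assms(3) unfolding st .
  moreover have "bipath_le n m (cov s) (cov s)"
    using covering_carrier[OF zz_pos_carrier[of s]] nm by (auto simp: bipath_carrier_def bipath_le_def)
  ultimately show ?thesis
    unfolding st using cov_adjacent(1)[of s] cov_adjacent(2)[of t] by auto
qed

text \<open>
  Comparable elements lie on a common chain.  Both chains have the lifting property: between two
  positions of the same window, the covering map runs monotonically through the chain.
\<close>

lemma comparable_same_chain:
  assumes "i \<in> bipath_carrier n m" "j \<in> bipath_carrier n m" "bipath_le n m i j"
  shows "i \<le> n \<and> j \<le> n \<or> (\<exists>a\<le>m. \<exists>b\<le>m. i = right_chain n m a \<and> j = right_chain n m b)"
proof (cases "i \<le> n \<and> j \<le> n")
  case False
  have *: "\<exists>a\<le>m. i = right_chain n m a" if "i \<in> bipath_carrier n m" "i = 0 \<or> n \<le> i" for i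
  proof (cases "i = 0")
    case True
    then show ?thesis
      by (auto simp: right_chain_def)
  next
    case False
    then show ?thesis
      using right_chain_of[of i n m] that nm by auto
  qed
  have "(i = 0 \<or> n \<le> i) \<and> (j = 0 \<or> n \<le> j)"
    using assms False by (auto simp: bipath_le_def)
  then show ?thesis
    using *[OF assms(1)] *[OF assms(2)] by blast
qed simp

lemma right_chain_inj:
  "0 < n \<Longrightarrow> i \<le> m \<Longrightarrow> j \<le> m \<Longrightarrow> right_chain n m i = right_chain n m j \<Longrightarrow> i = j"
  by (auto simp: right_chain_def split: if_splits)

lemma cov_left_fibre:
  assumes "cov t \<le> n"
  obtains k w where "t = 2 * k * period + w" "1 \<le> w" "w \<le> 2 * int n"
proof -
  obtain k w where w: "t = 2 * k * period + w" "1 \<le> w" "w < 1 + 2 * period"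
    by (rule position_cases)
  show thesis
  proof (cases "w \<le> 2 * int n")
    case False
    have "cov t = right_chain n m (nat (period + 1 - (w + 1) div 2))"
      unfolding w(1) using False w by (intro cov_right) auto
    moreover have "int n < (w + 1) div 2" "(w + 1) div 2 < period + 1"
      using False w by presburger+
    ultimately have "n < cov t"
      using period by (simp add: right_chain_def)
    then show thesis
      using assms by simp
  qed (use that w in blast)
qed

lemma cov_right_fibre:
  assumes "cov t = right_chain n m a" "a \<le> m"
  obtains k w where "t = 2 * k * period + w" "2 * int n \<le> w" "w \<le> 2 * period + 1"
    "period + 1 - (w + 1) div 2 = int a"
proof -
  obtain k w where w: "t = 2 * k * period + w" "2 \<le> w" "w < 2 + 2 * period"
    by (rule position_cases)
  show thesis
  proof (cases "2 * int n \<le> w")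
    case True
    have "cov t = right_chain n m (nat (period + 1 - (w + 1) div 2))"
      unfolding w(1) using True w by (intro cov_right) auto
    moreover have b: "int n \<le> (w + 1) div 2" "(w + 1) div 2 \<le> period + 1"
      using True w by presburger+
    ultimately have "nat (period + 1 - (w + 1) div 2) = a"
      using assms period nm by (intro right_chain_inj[OF _ _ assms(2)]) simp_all
    then have "period + 1 - (w + 1) div 2 = int a"
      using b(2) by linarith
    then show thesis
      using that[OF w(1) True] w(3) by simp
  next
    case False
    have "cov t = nat (w div 2)"
      unfolding w(1) using False w by (intro cov_left) auto
    moreover have "0 < w div 2" "w div 2 < int n"
      using False w by presburger+
    ultimately show thesis
      using assms by (auto simp: right_chain_def split: if_splits)
  qed
qed

lemma nat_between:
  "min a b \<le> c \<Longrightarrow> c \<le> max a b \<Longrightarrow> nat c \<in> {min (nat a) (nat b)..max (nat a) (nat b)}"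
  by (auto simp: min_def max_def split: if_splits)

lemma nat_between_diff:
  assumes "min x y \<le> z" "z \<le> max x y" "p - x = int a" "p - y = int b"
  shows "nat (p - z) \<in> {min a b..max a b}"
proof (cases "x \<le> y")
  case True
  then have "int b \<le> p - z" "p - z \<le> int a" "int b \<le> int a"
    using assms by simp_all
  then show ?thesis
    by (simp add: le_nat_iff nat_le_iff)
next
  case False
  then have "int a \<le> p - z" "p - z \<le> int b" "int a \<le> int b"
    using assms by simp_all
  then show ?thesis
    by (simp add: le_nat_iff nat_le_iff)
qed

abbreviation preimage :: "nat set \<Rightarrow> (int \<times> int) set" where
  "preimage I \<equiv> {x \<in> zz_carrier. covering n m x \<in> I}"

lemma conn_left:
  assumes "1 \<le> w" "w \<le> 2 * int n" "1 \<le> w'" "w' \<le> 2 * int n"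
    and "{min (nat (w div 2)) (nat (w' div 2))..max (nat (w div 2)) (nat (w' div 2))} \<subseteq> I"
  shows "(zz_pos (2 * k * period + w), zz_pos (2 * k * period + w')) \<in> conn zz_le (preimage I)"
proof (rule conn_zz_between)
  fix u
  define v where "v = u - 2 * k * period"
  have u: "u = 2 * k * period + v"
    by (simp add: v_def)
  assume "min (2 * k * period + w) (2 * k * period + w') \<le> u"
    "u \<le> max (2 * k * period + w) (2 * k * period + w')"
  then have v: "min w w' \<le> v" "v \<le> max w w'"
    unfolding u by auto
  then have "1 \<le> v" "v \<le> 2 * int n"
    using assms(1-4) by auto
  then have "cov u = nat (v div 2)"
    unfolding u by (rule cov_left)
  moreover have "min (w div 2) (w' div 2) \<le> v div 2" "v div 2 \<le> max (w div 2) (w' div 2)"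
    using v by (auto simp: min_def max_def zdiv_mono1 split: if_splits)
  ultimately have "cov u \<in> I"
    using nat_between[of "w div 2" "w' div 2" "v div 2"] assms(5) by (metis subsetD)
  then show "zz_pos u \<in> preimage I"
    using zz_pos_carrier by simp
qed

lemma conn_right:
  assumes w: "2 * int n \<le> w" "w \<le> 2 * period + 1" "period + 1 - (w + 1) div 2 = int a"
    and w': "2 * int n \<le> w'" "w' \<le> 2 * period + 1" "period + 1 - (w' + 1) div 2 = int b"
    and I: "right_chain n m ` {min a b..max a b} \<subseteq> I"
  shows "(zz_pos (2 * k * period + w), zz_pos (2 * k * period + w')) \<in> conn zz_le (preimage I)"
proof (rule conn_zz_between)
  fix u
  define v where "v = u - 2 * k * period"
  have u: "u = 2 * k * period + v"
    by (simp add: v_def)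
  assume "min (2 * k * period + w) (2 * k * period + w') \<le> u"
    "u \<le> max (2 * k * period + w) (2 * k * period + w')"
  then have v: "min w w' \<le> v" "v \<le> max w w'"
    unfolding u by auto
  then have "2 * int n \<le> v" "v \<le> 2 * period + 1"
    using w w' by auto
  then have c: "cov u = right_chain n m (nat (period + 1 - (v + 1) div 2))"
    unfolding u by (rule cov_right)
  have "min ((w + 1) div 2) ((w' + 1) div 2) \<le> (v + 1) div 2" "(v + 1) div 2 \<le> max ((w + 1) div 2) ((w' + 1) div 2)"
    using v by (auto simp: min_def max_def zdiv_mono1 split: if_splits)
  from nat_between_diff[OF this w(3) w'(3)]
  have "nat (period + 1 - (v + 1) div 2) \<in> {min a b..max a b}" .
  then have "cov u \<in> I"
    unfolding c using I by blast
  then show "zz_pos u \<in> preimage I"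
    using zz_pos_carrier by simp
qed

abbreviation "interval \<equiv> is_interval_of (bipath_carrier n m) (bipath_le n m)"

lemma interval_left:
  assumes "interval I" "i \<in> I" "j \<in> I" "i \<le> n" "j \<le> n"
  shows "{min i j..max i j} \<subseteq> I"
proof
  fix z assume "z \<in> {min i j..max i j}"
  then have "z \<in> bipath_carrier n m \<and> (bipath_le n m i z \<and> bipath_le n m z j \<or> bipath_le n m j z \<and> bipath_le n m z i)"
    using assms(4,5) nm by (auto simp: bipath_le_def bipath_carrier_def min_def max_def split: if_splits)
  then show "z \<in> I"
    using is_interval_ofD(3)[OF assms(1)] assms(2,3) by blast
qed

lemma interval_right:
  assumes "interval I" "right_chain n m a \<in> I" "right_chain n m b \<in> I" "a \<le> m" "b \<le> m"
  shows "right_chain n m ` {min a b..max a b} \<subseteq> I"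
proof (rule image_subsetI)
  let ?r = "right_chain n m"
  fix z assume z: "z \<in> {min a b..max a b}"
  then have "?r z \<in> bipath_carrier n m"
    using assms(4,5) nm by (intro right_chain_carrier) auto
  moreover have "bipath_le n m (?r a) (?r z) \<and> bipath_le n m (?r z) (?r b)
      \<or> bipath_le n m (?r b) (?r z) \<and> bipath_le n m (?r z) (?r a)"
    using z assms(4,5) nm by (cases "a \<le> b") (auto intro!: right_chain_le)
  ultimately show "?r z \<in> I"
    using is_interval_ofD(3)[OF assms(1)] assms(2,3) by blast
qed

text \<open>Path lifting, one comparable pair at a time.  The new endpoint is taken in the same window.\<close>

lemma covering_lift:
  assumes I: "interval I" and ij: "i \<in> I" "j \<in> I"
    and le: "bipath_le n m i j \<or> bipath_le n m j i" and t: "cov t = i"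
  shows "\<exists>t'. cov t' = j \<and> (zz_pos t, zz_pos t') \<in> conn zz_le (preimage I)"
proof -
  have "i \<in> bipath_carrier n m" "j \<in> bipath_carrier n m"
    using is_interval_ofD(1)[OF I] ij by auto
  then have "i \<le> n \<and> j \<le> n \<or> (\<exists>a\<le>m. \<exists>b\<le>m. i = right_chain n m a \<and> j = right_chain n m b)"
    using le comparable_same_chain[of i j] comparable_same_chain[of j i] by blast
  then show ?thesis
  proof (elim disjE exE conjE)
    assume n: "i \<le> n" "j \<le> n"
    obtain k w where w: "t = 2 * k * period + w" "1 \<le> w" "w \<le> 2 * int n"
      using cov_left_fibre[of t] t n by blast
    \<comment> \<open>The window starts at \<open>1\<close>, not at \<open>0\<close>: the fibre over \<open>0\<close> meets it in one position only.\<close>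
    define w' where "w' = max 1 (2 * int j)"
    have w': "1 \<le> w'" "w' \<le> 2 * int n" "nat (w' div 2) = j"
      using n nm by (auto simp: w'_def max_def)
    have "nat (w div 2) = i"
      using cov_left[OF w(2,3), of k] t w(1) by simp
    then have "{min (nat (w div 2)) (nat (w' div 2))..max (nat (w div 2)) (nat (w' div 2))} \<subseteq> I"
      using interval_left[OF I ij n] w'(3) by simp
    from conn_left[OF w(2,3) w'(1,2) this, of k] show ?thesis
      using w(1) cov_left[OF w'(1,2), of k] w'(3) by auto
  next
    fix a b assume ab: "a \<le> m" "b \<le> m" and r: "i = right_chain n m a" "j = right_chain n m b"
    obtain k w where w: "t = 2 * k * period + w" "2 * int n \<le> w" "w \<le> 2 * period + 1"
      "period + 1 - (w + 1) div 2 = int a"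
      using cov_right_fibre[of t a] t r ab by blast
    \<comment> \<open>For \<open>b = 0\<close> the position \<open>2N + 2\<close> would be too far by one, again because of the fibre over \<open>0\<close>.\<close>
    define w' where "w' = min (2 * period + 1) (2 * (period + 1 - int b))"
    have w': "2 * int n \<le> w'" "w' \<le> 2 * period + 1" "period + 1 - (w' + 1) div 2 = int b"
      using ab period by (auto simp: w'_def min_def)
    from conn_right[OF w(2-4) w'] show ?thesis
      using w(1) cov_right[OF w'(1,2), of k] w'(3) interval_right[OF I _ _ ab] ij r by auto
  qed
qed

lemma covering_surj:
  assumes "i \<in> bipath_carrier n m"
  shows "\<exists>t. cov t = i"
proof (cases "i \<le> n")
  case True
  then show ?thesis
    using cov_left[of "max 1 (2 * int i)" 0] nm by (intro exI[of _ "max 1 (2 * int i)"]) (auto simp: max_def)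
next
  case False
  then have "cov (2 * int i) = i"
    using cov_right[of "2 * int i" 0] assms nm period
    by (auto simp: bipath_carrier_def right_chain_def)
  then show ?thesis
    by blast
qed

text \<open>Points of one fibre differ by a shift, up to a path inside the fibre.\<close>

lemma covering_fibre:
  assumes I: "interval I" and s: "cov s \<in> I" and eq: "cov s = cov t"
  shows "\<exists>z. (zz_pos (s + 2 * z * period), zz_pos t) \<in> conn zz_le (preimage I)"
proof (cases "cov s \<le> n")
  case True
  then obtain k w k' w' where w: "s = 2 * k * period + w" "1 \<le> w" "w \<le> 2 * int n"
    and w': "t = 2 * k' * period + w'" "1 \<le> w'" "w' \<le> 2 * int n"
    using cov_left_fibre[of s] cov_left_fibre[of t] eq by metis
  have "nat (w div 2) = cov s" "nat (w' div 2) = cov s"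
    using cov_left[OF w(2,3), of k] cov_left[OF w'(2,3), of k'] w(1) w'(1) eq by auto
  from conn_left[OF w(2,3) w'(2,3), of I k', unfolded this] show ?thesis
    unfolding w(1) w'(1) using s by (intro exI[of _ "k' - k"]) (simp add: algebra_simps w(1))
next
  case False
  have "cov s \<in> bipath_carrier n m"
    using covering_carrier zz_pos_carrier .
  then obtain a where a: "cov s = right_chain n m a" "a \<le> m"
    using right_chain_of[of "cov s" n m] False nm by auto
  obtain k w where w: "s = 2 * k * period + w" "2 * int n \<le> w" "w \<le> 2 * period + 1"
      "period + 1 - (w + 1) div 2 = int a"
    using cov_right_fibre[OF a] by metis
  obtain k' w' where w': "t = 2 * k' * period + w'" "2 * int n \<le> w'" "w' \<le> 2 * period + 1"
      "period + 1 - (w' + 1) div 2 = int a"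
    using cov_right_fibre[of t a] a eq by metis
  from conn_right[OF w(2-4) w'(2-4), of I k'] show ?thesis
    unfolding w'(1) using s a by (intro exI[of _ "k' - k"]) (simp add: algebra_simps w(1))
qed

section \<open>Components of preimages of intervals\<close>

text \<open>The set of lifts of \<open>I\<close> is the orbit that corresponds to \<open>I\<close>.\<close>

definition lifts :: "nat set \<Rightarrow> (int \<times> int) set set" where
  "lifts I = components zz_le (preimage I)"

definition translate :: "int \<Rightarrow> int \<times> int \<Rightarrow> int \<times> int" where
  "translate z = (\<lambda>(a, b). (a + z * period, b + z * period))"

lemma shift_eq: "shift n m z J = translate z ` J"
  unfolding shift_def translate_def period_def ..

lemma translate_pos: "translate z (zz_pos t) = zz_pos (t + 2 * z * period)"
proof (cases "even t")
  case True
  then obtain v where v: "t = 2 * v"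
    by (rule evenE)
  have "t + 2 * z * period = 2 * (v + z * period)"
    by (simp add: v)
  then show ?thesis
    by (simp only: v zz_pos_even translate_def prod.case)
next
  case False
  then obtain v where v: "t = 2 * v + 1"
    by (rule oddE)
  have "t + 2 * z * period = 2 * (v + z * period) + 1"
    by (simp add: v)
  then show ?thesis
    by (simp only: v zz_pos_odd translate_def prod.case) simp
qed

lemma translate_translate: "translate z (translate z' x) = translate (z + z') x"
  by (simp add: translate_def algebra_simps split: prod.split)

lemma translate_0: "translate 0 x = x"
  by (simp add: translate_def split: prod.split)

lemma covering_translate: "covering n m (translate z x) = covering n m x"
proof (cases x)
  case (Pair a b)
  have "(b + z * period) mod period = b mod period"
    by simp
  from covering_mod[OF this, of "a + z * period"] covering_mod[of b "b mod period" a]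
  show ?thesis
    by (simp add: Pair translate_def)
qed

lemma translate_preimage: "x \<in> preimage I \<Longrightarrow> translate z x \<in> preimage I"
  by (auto simp: covering_translate) (auto simp: zz_carrier_def translate_def)

lemma zz_le_translate: "zz_le (translate z x) (translate z y) \<longleftrightarrow> zz_le x y"
  by (simp add: zz_le_def translate_def split: prod.split)

lemma conn_translate:
  assumes "(x, y) \<in> conn zz_le (preimage I)"
  shows "(translate z x, translate z y) \<in> conn zz_le (preimage I)"
  using assms unfolding conn_def[of zz_le "preimage I"]
proof (induction rule: rtrancl_induct)
  case (step y w)
  then have yw: "y \<in> preimage I" "w \<in> preimage I" "zz_le y w \<or> zz_le w y"
    by auto
  have "(translate z y, translate z w) \<in> conn zz_le (preimage I)"
    by (rule conn_step[OF translate_preimage[OF yw(1)] translate_preimage[OF yw(2)]])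
      (simp only: zz_le_translate yw(3))
  then show ?case
    using step.IH unfolding conn_def by (rule rtrancl_trans[rotated])
qed simp

lemma translate_component:
  "translate z ` (conn zz_le (preimage I) `` {x}) = conn zz_le (preimage I) `` {translate z x}"
proof
  show "translate z ` (conn zz_le (preimage I) `` {x}) \<subseteq> conn zz_le (preimage I) `` {translate z x}"
    using conn_translate by auto
  show "conn zz_le (preimage I) `` {translate z x} \<subseteq> translate z ` (conn zz_le (preimage I) `` {x})"
  proof
    fix y assume "y \<in> conn zz_le (preimage I) `` {translate z x}"
    then have "(x, translate (- z) y) \<in> conn zz_le (preimage I)"
      using conn_translate[of "translate z x" y I "- z"] by (simp add: translate_translate translate_0)
    moreover have "y = translate z (translate (- z) y)"
      by (simp add: translate_translate translate_0)
    ultimately show "y \<in> translate z ` (conn zz_le (preimage I) `` {x})"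
      by blast
  qed
qed

text \<open>By path lifting, the points of \<open>I\<close> over which \<open>C\<close> has a point are closed under comparability.\<close>

lemma covering_image_lift:
  assumes I: "interval I" and C: "C \<in> lifts I"
  shows "covering n m ` C = I"
proof
  show "covering n m ` C \<subseteq> I"
    using components_eq_conn(1)[OF C[unfolded lifts_def]] by auto
  obtain x where x: "x \<in> preimage I" "C = conn zz_le (preimage I) `` {x}"
    using C unfolding lifts_def components_def by blast
  obtain t where t: "x = zz_pos t"
    using x zz_carrier_pos by blast
  have step: "\<exists>u. cov u = j \<and> (zz_pos t, zz_pos u) \<in> conn zz_le (preimage I)"
    if ij: "i \<in> I" "j \<in> I" "bipath_le n m i j \<or> bipath_le n m j i"
      and ex: "\<exists>u. cov u = i \<and> (zz_pos t, zz_pos u) \<in> conn zz_le (preimage I)" for i j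
  proof -
    obtain u where u: "cov u = i" "(zz_pos t, zz_pos u) \<in> conn zz_le (preimage I)"
      using ex by blast
    obtain u' where "cov u' = j" "(zz_pos u, zz_pos u') \<in> conn zz_le (preimage I)"
      using covering_lift[OF I ij u(1)] by blast
    then show ?thesis
      using conn_trans[OF u(2)] by blast
  qed
  show "I \<subseteq> covering n m ` C"
  proof
    fix i assume i: "i \<in> I"
    have t0: "cov t \<in> I"
      using x(1) t by simp
    let ?Q = "\<lambda>i. \<exists>u. cov u = i \<and> (zz_pos t, zz_pos u) \<in> conn zz_le (preimage I)"
    have "?Q i"
    proof (rule interval_connected_induct[OF I t0 i, where Q = ?Q])
      show "?Q (cov t)"
        by (intro exI[of _ t] conjI refl conn_refl)
      show "?Q z" if "y \<in> I" "z \<in> I" "bipath_le n m y z" "?Q y" for y z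
        by (rule step[OF that(1,2) disjI1[OF that(3)] that(4)])
      show "?Q z" if "y \<in> I" "z \<in> I" "bipath_le n m z y" "?Q y" for y z
        by (rule step[OF that(1,2) disjI2[OF that(3)] that(4)])
    qed
    then show "i \<in> covering n m ` C"
      unfolding x(2) t by force
  qed
qed

lemma lifts_nonempty:
  assumes "interval I"
  shows "lifts I \<noteq> {}"
proof -
  obtain i where "i \<in> I" "i \<in> bipath_carrier n m"
    using is_interval_ofD(1,2)[OF assms] by blast
  then obtain t where "zz_pos t \<in> preimage I"
    using covering_surj zz_pos_carrier by fastforce
  then show ?thesis
    unfolding lifts_def components_def by blast
qed

text \<open>
  Two lifts both have points over any chosen point of \<open>I\<close>; these differ by a shift and a path in the
  preimage, so the shift carries one lift to the other.
\<close>

lemma lifts_eq_orbit: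
  assumes I: "interval I" and C: "C \<in> lifts I"
  shows "lifts I = {shift n m z C |z. True}"
proof -
  let ?c = "conn zz_le (preimage I)"
  obtain x where x: "x \<in> preimage I" "C = ?c `` {x}"
    using C unfolding lifts_def components_def by blast
  have "shift n m z C \<in> lifts I" for z
    unfolding shift_eq x(2) translate_component lifts_def components_def
    using translate_preimage[OF x(1)] by blast
  moreover have "\<exists>z. D = shift n m z C" if D: "D \<in> lifts I" for D
  proof -
    obtain y where y: "y \<in> D" "covering n m y = covering n m x"
      using covering_image_lift[OF I D] x(1) by (metis (mono_tags, lifting) imageE mem_Collect_eq)
    have yD: "y \<in> preimage I" "D = ?c `` {y}"
      using components_eq_conn D y(1) unfolding lifts_def by fast+
    obtain s t where st: "x = zz_pos s" "y = zz_pos t"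
      using x(1) yD(1) zz_carrier_pos by (metis (mono_tags, lifting) mem_Collect_eq)
    have "cov s \<in> I" "cov s = cov t"
      using x(1) y(2) unfolding st by simp_all
    then obtain z where "(zz_pos (s + 2 * z * period), zz_pos t) \<in> ?c"
      using covering_fibre[OF I] by blast
    then have "(translate z x, y) \<in> ?c"
      unfolding st translate_pos .
    then have "D = shift n m z C"
      unfolding shift_eq x(2) translate_component yD(2) by (rule component_eq[symmetric])
    then show ?thesis
      by blast
  qed
  ultimately show ?thesis
    by blast
qed

section \<open>Arc codes and barcodes\<close>

lemma restriction_eq_pullback: "restriction n m M = pullback (covering n m) M"
  unfolding restriction_def pullback_def ..

text \<open>
  The arc code and the barcode are read off from one interval basis and its pull-back.  A zigzag
  interval occurs as a lift of one interval only, its image, so that copies are not merged.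
\<close>

lemma arc_code_and_barcode:
  fixes M :: "(nat, 'k::field, 'v::ab_group_add) pmod"
  assumes M: "bipath_module n m M"
  shows "is_interval_decomposition (bipath_carrier n m) (bipath_le n m) M (arc_code n m M)"
    and "interval I \<Longrightarrow> C \<in> lifts I \<Longrightarrow> barcode (restriction n m M) C = arc_code n m M I"
    and "0 < barcode (restriction n m M) C \<Longrightarrow> \<exists>I\<in>occurring (arc_code n m M). C \<in> lifts I"
proof -
  interpret pers_module "bipath_carrier n m" "bipath_le n m" M
    using M unfolding bipath_module_def by unfold_locales
  have pb: "persistence_module zz_carrier zz_le (restriction n m M)"
    unfolding restriction_eq_pullback
    by (rule persistence_module_pullback) (use covering_mono covering_carrier in blast)+
  interpret R: pers_module zz_carrier zz_le "restriction n m M"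
    using pb by unfold_locales
  obtain k :: nat and J x \<phi> where B: "interval_basis (bipath_carrier n m) (bipath_le n m) M {..<k} J x \<phi>"
    using bipath_interval_basis[OF nm M] by blast
  note dec = interval_basis_imp_decomposition[OF B]
  have arc: "arc_code n m M = (\<lambda>I. card {a \<in> {..<k}. J a = I})"
    unfolding arc_code_def by (rule interval_multiset_eq[OF dec])
  let ?A = "{(a, C). a \<in> {..<k} \<and> C \<in> lifts (J a)}"
  have "interval_basis zz_carrier zz_le (restriction n m M) ?A snd
    (\<lambda>a q. x (fst a) (covering n m q)) (\<lambda>a q. \<phi> (fst a) (covering n m q))"
    unfolding restriction_eq_pullback lifts_def
    by (rule interval_basis_pullback[OF _ _ B]) (use covering_mono covering_carrier in blast)+
  from R.interval_basis_imp_decomposition[OF this]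
  have bar: "barcode (restriction n m M) = (\<lambda>C. card {a \<in> ?A. snd a = C})"
    unfolding barcode_def by (rule R.interval_multiset_eq)
  have bar': "barcode (restriction n m M) C = card {a \<in> {..<k}. C \<in> lifts (J a)}" for C
  proof -
    have "{a \<in> ?A. snd a = C} = {a \<in> {..<k}. C \<in> lifts (J a)} \<times> {C}"
      by auto
    then show ?thesis
      unfolding bar by (simp add: card_cartesian_product)
  qed
  show "is_interval_decomposition (bipath_carrier n m) (bipath_le n m) M (arc_code n m M)"
    using dec unfolding arc .
  show "barcode (restriction n m M) C = arc_code n m M I" if "interval I" "C \<in> lifts I"
  proof -
    have "{a \<in> {..<k}. C \<in> lifts (J a)} = {a \<in> {..<k}. J a = I}"
      using covering_image_lift[OF that] covering_image_lift[OF interval_basisD(1)[OF B]] that(2) by blast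
    then show ?thesis
      unfolding bar' arc by simp
  qed
  show "\<exists>I\<in>occurring (arc_code n m M). C \<in> lifts I" if "0 < barcode (restriction n m M) C"
  proof -
    have "{a \<in> {..<k}. C \<in> lifts (J a)} \<noteq> {}"
      using that unfolding bar' by (metis card.empty less_irrefl)
    then obtain a where a: "a \<in> {..<k}" "C \<in> lifts (J a)"
      by blast
    then have "{b \<in> {..<k}. J b = J a} \<noteq> {}"
      by blast
    then have "J a \<in> occurring (arc_code n m M)"
      unfolding occurring_def arc by (simp only: mem_Collect_eq card_gt_0_iff) simp
    then show ?thesis
      using a(2) by blast
  qed
qed

lemma occurring_interval:
  assumes "bipath_module n m M" "I \<in> occurring (arc_code n m M)"
  shows "interval I"
  using arc_code_and_barcode(1)[OF assms(1)] assms(2) unfolding is_interval_decomposition_def by blast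

lemma iso_iff_barcode_eq:
  assumes M: "bipath_module n m M" and M': "bipath_module n m M'"
  shows "bipath_iso n m M M' \<longleftrightarrow> barcode (restriction n m M) = barcode (restriction n m M')"
proof
  assume "bipath_iso n m M M'"
  then have "pm_iso zz_carrier zz_le (restriction n m M) (restriction n m M')"
    unfolding bipath_iso_def restriction_eq_pullback
    by (rule pm_iso_pullback[rotated 2]) (use covering_mono covering_carrier in blast)+
  then have "is_interval_decomposition zz_carrier zz_le (restriction n m M)
      = is_interval_decomposition zz_carrier zz_le (restriction n m M')"
    by (intro ext decomposition_iso)
  then show "barcode (restriction n m M) = barcode (restriction n m M')"
    unfolding barcode_def interval_multiset_def by simp
next
  assume eq: "barcode (restriction n m M) = barcode (restriction n m M')"
  have "arc_code n m M I = arc_code n m M' I" for I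
  proof (cases "interval I")
    case True
    then obtain C where "C \<in> lifts I"
      using lifts_nonempty by blast
    then show ?thesis
      using arc_code_and_barcode(2)[OF M True] arc_code_and_barcode(2)[OF M' True] eq by metis
  next
    case False
    then show ?thesis
      using occurring_interval[OF M, of I] occurring_interval[OF M', of I] unfolding occurring_def
      by (metis gr0I mem_Collect_eq)
  qed
  then have arc: "arc_code n m M = arc_code n m M'"
    by blast
  show "bipath_iso n m M M'"
    unfolding bipath_iso_def
  proof (rule pm_iso_trans[OF _ pm_iso_sym])
    let ?D = "direct_sum_pm {(I, j). j < arc_code n m M I} (\<lambda>(I, j). interval_module I)"
    show "pm_iso (bipath_carrier n m) (bipath_le n m) M ?D"
      using arc_code_and_barcode(1)[OF M] unfolding is_interval_decomposition_def by (rule conjunct2)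
    show "pm_iso (bipath_carrier n m) (bipath_le n m) M' ?D"
      using arc_code_and_barcode(1)[OF M'] unfolding is_interval_decomposition_def arc by (rule conjunct2)
  qed
qed

lemma bij_betw_lifts:
  assumes M: "bipath_module n m M"
  shows "bij_betw lifts (occurring (arc_code n m M))
    (orbit_space n m (occurring (barcode (restriction n m M))))"
  unfolding bij_betw_def
proof
  let ?S = "occurring (arc_code n m M)" and ?S' = "occurring (barcode (restriction n m M))"
  note int = occurring_interval[OF M]
  show "inj_on lifts ?S"
  proof (rule inj_onI)
    fix I J assume IJ: "I \<in> ?S" "J \<in> ?S" "lifts I = lifts J"
    obtain C where "C \<in> lifts I"
      using lifts_nonempty[OF int[OF IJ(1)]] by blast
    then show "I = J"
      using covering_image_lift[OF int[OF IJ(1)]] covering_image_lift[OF int[OF IJ(2)]] IJ(3) by blast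
  qed
  show "lifts ` ?S = orbit_space n m ?S'"
  proof
    show "lifts ` ?S \<subseteq> orbit_space n m ?S'"
    proof (rule image_subsetI)
      fix I assume I: "I \<in> ?S"
      obtain C where C: "C \<in> lifts I"
        using lifts_nonempty[OF int[OF I]] by blast
      have "C \<in> ?S'"
        using arc_code_and_barcode(2)[OF M int[OF I] C] I by (simp add: occurring_def)
      then show "lifts I \<in> orbit_space n m ?S'"
        unfolding lifts_eq_orbit[OF int[OF I] C] orbit_space_def by (rule imageI)
    qed
    show "orbit_space n m ?S' \<subseteq> lifts ` ?S"
      unfolding orbit_space_def
    proof (rule image_subsetI)
      fix C assume "C \<in> ?S'"
      then obtain I where I: "I \<in> ?S" "C \<in> lifts I"
        using arc_code_and_barcode(3)[OF M, of C] by (auto simp: occurring_def)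
      show "{shift n m z C |z. True} \<in> lifts ` ?S"
        unfolding lifts_eq_orbit[OF int[OF I(1)] I(2), symmetric] using I(1) by (rule imageI)
    qed
  qed
qed

end

theorem theorem2p3:
  fixes n m :: nat
  assumes "n > 1" and "m > 1"
  shows "(\<forall>(M1 :: (nat, 'k::field, 'v::ab_group_add) pmod) (M2 :: (nat, 'k, 'w::ab_group_add) pmod).
            bipath_module n m M1 \<longrightarrow> bipath_module n m M2 \<longrightarrow>
            (bipath_iso n m M1 M2 \<longleftrightarrow>
               barcode (restriction n m M1) = barcode (restriction n m M2))) \<and>
         (\<forall>M :: (nat, 'k, 'v) pmod. bipath_module n m M \<longrightarrow>
            (let \<mu> = arc_code n m M; S = occurring \<mu>;
                 \<mu>' = barcode (restriction n m M); S' = occurring \<mu>'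
             in \<exists>\<phi>. bij_betw \<phi> S (orbit_space n m S') \<and>
                     (\<forall>I\<in>S. \<forall>J\<in>\<phi> I. \<mu>' J = \<mu> I)))"
proof -
  interpret bipath_covering n m
    using assms by unfold_locales
  show ?thesis
    unfolding Let_def
  proof (intro conjI allI impI)
    fix M1 :: "(nat, 'k, 'v) pmod" and M2 :: "(nat, 'k, 'w) pmod"
    assume "bipath_module n m M1" "bipath_module n m M2"
    then show "bipath_iso n m M1 M2 \<longleftrightarrow> barcode (restriction n m M1) = barcode (restriction n m M2)"
      by (rule iso_iff_barcode_eq)
  next
    fix M :: "(nat, 'k, 'v) pmod"
    assume M: "bipath_module n m M"
    show "\<exists>\<phi>. bij_betw \<phi> (occurring (arc_code n m M))
          (orbit_space n m (occurring (barcode (restriction n m M)))) \<and>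
        (\<forall>I\<in>occurring (arc_code n m M). \<forall>J\<in>\<phi> I. barcode (restriction n m M) J = arc_code n m M I)"
      using bij_betw_lifts[OF M] arc_code_and_barcode(2)[OF M occurring_interval[OF M]] by blast
  qed
qed

end
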